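(* For any $n\geq 2$, the number $SB_n$ of semi-Baxter permutations of size $n$ satisfies $$\begin{aligned}SB_n&=\frac{24}{(n-1)n^2(n+1)(n+2)}\sum_{j=0}^n\binom{n}{j+2}\binom{n+2}{j}\binom{n+j+2}{j+1}\\&=\frac{24}{(n-1)n^2(n+1)(n+2)}\sum_{j=0}^n\binom{n}{j+2}\binom{n+1}{j}\binom{n+j+2}{j+3}\\&=\frac{24}{(n-1)n^2(n+1)(n+2)}\sum_{j=0}^n\binom{n+1}{j+3}\binom{n+2}{j+1}\binom{n+j+3}{j}.\end{aligned}$$
   Context: A permutation $\pi$ of $\{1,\dots,n\}$ is semi-Baxter if there are no indices $i<j$ and $k>j+1$ such that $\pi_{j+1}<\pi_i<\pi_k<\pi_j$. Binomial coefficients $\binom{m}{r}$ are $0$ when $r>m\geq 0$. *)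

theory Defs
  imports Complex_Main "HOL-Combinatorics.Permutations"
begin

definition semi_baxter :: "nat \<Rightarrow> (nat \<Rightarrow> nat) \<Rightarrow> bool" where
  "semi_baxter n \<pi> \<longleftrightarrow> \<pi> permutes {1..n} \<and>
     \<not> (\<exists>i j k. 1 \<le> i \<and> i < j \<and> j + 1 < k \<and> k \<le> n \<and>
          \<pi> (j + 1) < \<pi> i \<and> \<pi> i < \<pi> k \<and> \<pi> k < \<pi> j)"

definition SB :: "nat \<Rightarrow> nat" where
  "SB n = card {\<pi>. semi_baxter n \<pi>}"

end

theory Submission
  imports Defs "HOL-Computational_Algebra.Formal_Laurent_Series"
begin

text \<open>
Every semi-Baxter permutation of size \<open>n + 1\<close> arises exactly once from one of size \<open>n\<close> by
appending a last value \<open>s\<close> and raising the entries that are at least \<open>s\<close>. Call \<open>s\<close> active if the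
result is again semi-Baxter, and label a permutation by the numbers \<open>(h, k)\<close> of active values that
are at most, respectively above, its last entry. The labels of the children depend on \<open>(h, k)\<close> only:
they are \<open>(1, k + 1), \<dots>, (h, k + 1)\<close> and \<open>(h + k, 1), \<dots>, (h + 1, k)\<close> (lemma \<open>label_sum_children\<close>).
Hence the polynomials \<open>S\<^sub>n(y, z) = \<Sum> y\<^sup>h z\<^sup>k\<close> satisfy a recurrence that involves, besides
\<open>S\<^sub>n(y, z)\<close>, the two specialisations \<open>S\<^sub>n(1, z)\<close> and \<open>S\<^sub>n(y, y)\<close> (lemma \<open>label_poly_Suc\<close>).

The resulting functional equation is solved by the kernel method. Whenever
\<open>x y z (z - 1) = (y - 1) (z - y)\<close>, the term \<open>S(y, z)\<close> drops out and a linear relation between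
\<open>U(y) = \<Sum> S\<^sub>n(y, y) x\<^sup>n\<close> and \<open>V(z) = \<Sum> S\<^sub>n(1, z) x\<^sup>n\<close> remains (lemma \<open>kernel_relation\<close>). This curve is
preserved by the two involutions that exchange, for fixed \<open>x\<close>, the two solutions \<open>y\<close> for given \<open>z\<close> and the two
solutions \<open>z\<close> for given \<open>y\<close>; together they generate a group of order ten. Starting from
\<open>y = 1 + a\<close> and \<open>z = 1 + a + u\<close>, five points of the orbit can be substituted into the series, and
neighbours share a coordinate. Eliminating the four intermediate unknowns leaves
\<open>U(1 + a) + x (1 + a)\<^sup>2 a\<^sup>-\<^sup>4 V(1 + 1/a) = F(a, u)\<close> with an explicit rational function \<open>F\<close>
(lemma \<open>orbit_relations\<close>). Expanded in powers of \<open>x\<close>, the second summand has coefficients with only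
negative powers of \<open>a\<close>, so the part of degree \<open>0\<close> in \<open>a\<close> is \<open>U(1)\<close>, the generating function of the
semi-Baxter numbers.

The usual presentation views \<open>u\<close> as a power series in \<open>x\<close>. Here it is more convenient to take \<open>u\<close> as
the variable, so that \<open>x = a u / ((1 + a) (u + a) (u + 1 + a))\<close> is an explicit power series in \<open>u\<close>
whose coefficients are Laurent series in \<open>a\<close>; the coefficients with respect to powers of \<open>x\<close> are
then recovered by Lagrange inversion (lemma \<open>lagrange_inversion\<close>). This writes the number of
semi-Baxter permutations as a single sum whose summand is a signed combination of ten products of
three binomial coefficients (lemma \<open>SB_eq_extraction_sum\<close>).

It remains to compare binomial sums. Each comparison is a telescoping one: up to a factor
independent of \<open>j\<close>, the difference of the summands is \<open>G(j + 1) - G(j)\<close> for a hypergeometric \<open>G\<close> that vanishes at both ends, as found by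
Gosper's algorithm. Writing binomial coefficients by means of \<open>1 / k!\<close>, extended by \<open>0\<close> to negative
integers, turns these statements into polynomial identities that hold for all \<open>j\<close>, without
exceptional boundary cases.
\<close>

section \<open>Appending a last value to a semi-Baxter permutation\<close>

definition push_above :: "nat \<Rightarrow> nat \<Rightarrow> nat" where
  "push_above s v = (if s \<le> v then Suc v else v)"

definition append_value :: "nat \<Rightarrow> nat \<Rightarrow> (nat \<Rightarrow> nat) \<Rightarrow> nat \<Rightarrow> nat" where
  "append_value n s \<pi> =
     (\<lambda>i. if i = Suc n then s else if i \<in> {1..n} then push_above s (\<pi> i) else i)"

text \<open>
Appending \<open>s\<close> as the last entry can only create forbidden patterns in which the last entry plays the
role of the 3 of the vincular pattern 2-41-3; the conditions \<open>i < j < n\<close> locate its 2, 4 and 1.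
\<close>

definition active :: "nat \<Rightarrow> (nat \<Rightarrow> nat) \<Rightarrow> nat set" where
  "active n \<pi> = {s \<in> {1..Suc n}. \<not> (\<exists>i j. 1 \<le> i \<and> i < j \<and> j < n \<and>
     \<pi> (j + 1) < \<pi> i \<and> \<pi> i < s \<and> s \<le> \<pi> j)}"

definition active_below :: "nat \<Rightarrow> (nat \<Rightarrow> nat) \<Rightarrow> nat" where
  "active_below n \<pi> = card {s \<in> active n \<pi>. s \<le> \<pi> n}"

definition active_above :: "nat \<Rightarrow> (nat \<Rightarrow> nat) \<Rightarrow> nat" where
  "active_above n \<pi> = card {s \<in> active n \<pi>. \<pi> n < s}"

lemma push_above_less_iff [simp]: "push_above s u < push_above s v \<longleftrightarrow> u < v"
  by (auto simp: push_above_def)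

lemma push_above_less [simp]: "push_above s v < s \<longleftrightarrow> v < s"
  and less_push_above [simp]: "s < push_above s v \<longleftrightarrow> s \<le> v"
  and push_above_neq [simp]: "push_above s v \<noteq> s"
  by (auto simp: push_above_def)

lemma push_above_inj: "push_above s u = push_above s v \<longleftrightarrow> u = v"
  by (auto simp: push_above_def)

lemma push_above_small:
  assumes "t \<le> s"
  shows "push_above s v < t \<longleftrightarrow> v < t" and "t \<le> push_above s v \<longleftrightarrow> t \<le> v"
  using assms by (auto simp: push_above_def)

lemma push_above_large:
  assumes "s \<le> t"
  shows "push_above s v < Suc t \<longleftrightarrow> v < t" and "Suc t \<le> push_above s v \<longleftrightarrow> t \<le> v"
  using assms by (auto simp: push_above_def)

lemma append_value_last [simp]: "append_value n s \<pi> (Suc n) = s"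
  by (simp add: append_value_def)

lemma append_value_old [simp]: "1 \<le> i \<Longrightarrow> i \<le> n \<Longrightarrow> append_value n s \<pi> i = push_above s (\<pi> i)"
  by (simp add: append_value_def)

lemma append_value_permutes:
  assumes p: "\<pi> permutes {1..n}" and s: "s \<in> {1..Suc n}"
  shows "append_value n s \<pi> permutes {1..Suc n}"
proof (rule bij_imp_permutes)
  let ?f = "append_value n s \<pi>"
  have inj: "inj_on ?f {1..Suc n}"
  proof (rule inj_onI)
    fix i j assume ij: "i \<in> {1..Suc n}" "j \<in> {1..Suc n}" "?f i = ?f j"
    show "i = j"
      using ij permutes_inj[OF p]
      by (cases "i = Suc n"; cases "j = Suc n")
        (auto simp: append_value_def push_above_inj inj_def dest: sym)
  qed
  have "?f ` {1..Suc n} \<subseteq> {1..Suc n}"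
  proof safe
    fix i assume i: "i \<in> {1..Suc n}"
    show "?f i \<in> {1..Suc n}"
    proof (cases "i = Suc n")
      case False
      then have "i \<in> {1..n}" using i by auto
      then have "\<pi> i \<in> {1..n}" using permutes_in_image[OF p] by blast
      then show ?thesis using \<open>i \<in> {1..n}\<close> by (auto simp: push_above_def)
    qed (use s in auto)
  qed
  then show "bij_betw ?f {1..Suc n} {1..Suc n}"
    using inj by (simp add: bij_betw_def endo_inj_surj)
next
  fix x assume "x \<notin> {1..Suc n}"
  then show "append_value n s \<pi> x = x" by (auto simp: append_value_def)
qed

definition delete_last :: "nat \<Rightarrow> (nat \<Rightarrow> nat) \<Rightarrow> nat \<Rightarrow> nat" where
  "delete_last n \<rho> =
     (\<lambda>i. if i \<in> {1..n} then (if \<rho> (Suc n) < \<rho> i then \<rho> i - 1 else \<rho> i) else i)"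

lemma append_delete:
  assumes p: "\<rho> permutes {1..Suc n}"
  shows "append_value n (\<rho> (Suc n)) (delete_last n \<rho>) = \<rho>"
proof
  fix i
  show "append_value n (\<rho> (Suc n)) (delete_last n \<rho>) i = \<rho> i"
  proof (cases "i \<in> {1..n}")
    case True
    then have "\<rho> i \<noteq> \<rho> (Suc n)" by (auto simp: inj_eq[OF permutes_inj[OF p]])
    then show ?thesis using True by (auto simp: append_value_def delete_last_def push_above_def)
  next
    case False
    then show ?thesis using permutes_not_in[OF p, of i]
      by (cases "i = Suc n") (auto simp: append_value_def)
  qed
qed

lemma delete_append:
  assumes p: "\<pi> permutes {1..n}"
  shows "delete_last n (append_value n s \<pi>) = \<pi>"
proof
  fix i
  show "delete_last n (append_value n s \<pi>) i = \<pi> i"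
    using permutes_not_in[OF p, of i]
    by (auto simp: append_value_def delete_last_def push_above_def)
qed

lemma delete_last_permutes:
  assumes p: "\<rho> permutes {1..Suc n}"
  shows "delete_last n \<rho> permutes {1..n}"
proof (rule bij_imp_permutes)
  let ?f = "delete_last n \<rho>"
  have ne: "\<rho> i \<noteq> \<rho> (Suc n)" if "i \<in> {1..n}" for i
    using that by (auto simp: inj_eq[OF permutes_inj[OF p]])
  have range: "\<rho> i \<in> {1..Suc n}" if "i \<in> {1..Suc n}" for i
    using permutes_in_image[OF p] that by blast
  have restore: "push_above (\<rho> (Suc n)) (?f i) = \<rho> i" if "i \<in> {1..n}" for i
    using ne[OF that] that by (auto simp: delete_last_def push_above_def)
  have inj: "inj_on ?f {1..n}"
    by (rule inj_onI) (metis restore permutes_inj[OF p] injD)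
  have "?f ` {1..n} \<subseteq> {1..n}"
  proof safe
    fix i assume i: "i \<in> {1..n}"
    show "?f i \<in> {1..n}"
      using i ne[OF i] range[of i] range[of "Suc n"] by (auto simp: delete_last_def)
  qed
  then show "bij_betw ?f {1..n} {1..n}"
    using inj by (simp add: bij_betw_def endo_inj_surj)
qed (auto simp: delete_last_def)

lemma ex_triple_le_Suc:
  "(\<exists>i j k. 1 \<le> i \<and> i < j \<and> j + 1 < k \<and> k \<le> Suc n \<and> P i j k) \<longleftrightarrow>
   (\<exists>i j k. 1 \<le> i \<and> i < j \<and> j + 1 < k \<and> k \<le> n \<and> P i j k) \<or>
   (\<exists>i j. 1 \<le> i \<and> i < j \<and> j < n \<and> P i j (Suc n :: nat))"
  by (auto simp: le_Suc_eq) (use Suc_mono in blast)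

lemma semi_baxter_append_iff:
  assumes p: "\<pi> permutes {1..n}" and s: "s \<in> {1..Suc n}"
  shows "semi_baxter (Suc n) (append_value n s \<pi>) \<longleftrightarrow> semi_baxter n \<pi> \<and> s \<in> active n \<pi>"
proof -
  let ?f = "append_value n s \<pi>"
  let ?pat = "\<lambda>\<pi> i j k. \<pi> (j + 1) < \<pi> i \<and> \<pi> i < \<pi> k \<and> \<pi> k < (\<pi> j :: nat)"
  have old: "?pat ?f i j k \<longleftrightarrow> ?pat \<pi> i j k"
    if "1 \<le> i" "i < j" "j + 1 < k" "k \<le> n" for i j k
    using that by simp
  have new: "?pat ?f i j (Suc n) \<longleftrightarrow> \<pi> (j + 1) < \<pi> i \<and> \<pi> i < s \<and> s \<le> \<pi> j"
    if "1 \<le> i" "i < j" "j < n" for i j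
    using that by simp
  have "(\<exists>i j k. 1 \<le> i \<and> i < j \<and> j + 1 < k \<and> k \<le> Suc n \<and> ?pat ?f i j k) \<longleftrightarrow>
        (\<exists>i j k. 1 \<le> i \<and> i < j \<and> j + 1 < k \<and> k \<le> n \<and> ?pat ?f i j k) \<or>
        (\<exists>i j. 1 \<le> i \<and> i < j \<and> j < n \<and> ?pat ?f i j (Suc n))"
    by (rule ex_triple_le_Suc)
  also have "\<dots> \<longleftrightarrow>
        (\<exists>i j k. 1 \<le> i \<and> i < j \<and> j + 1 < k \<and> k \<le> n \<and> ?pat \<pi> i j k) \<or>
        (\<exists>i j. 1 \<le> i \<and> i < j \<and> j < n \<and> \<pi> (j + 1) < \<pi> i \<and> \<pi> i < s \<and> s \<le> \<pi> j)"
    by (intro arg_cong2[of _ _ _ _ "(\<or>)"] ex_cong1 conj_cong refl) (auto simp: old new)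
  finally show ?thesis
    using p s append_value_permutes[OF p s]
    unfolding semi_baxter_def active_def by simp
qed

lemma finite_semi_baxter: "finite {\<pi>. semi_baxter n \<pi>}"
  by (rule finite_subset[OF _ finite_permutations[of "{1..n}"]]) (auto simp: semi_baxter_def)

lemma finite_active [simp]: "finite (active n \<pi>)"
  by (simp add: active_def)

text \<open>
Deleting the last entry inverts appending an active value, and it never creates a pattern, so the
semi-Baxter permutations form a generating tree.
\<close>

lemma sum_semi_baxter_Suc:
  "(\<Sum>\<rho> | semi_baxter (Suc n) \<rho>. g \<rho>) =
   (\<Sum>\<pi> | semi_baxter n \<pi>. \<Sum>s\<in>active n \<pi>. g (append_value n s \<pi>))"
proof -
  have "(\<Sum>\<pi> | semi_baxter n \<pi>. \<Sum>s\<in>active n \<pi>. g (append_value n s \<pi>)) =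
        (\<Sum>(\<pi>, s)\<in>Sigma {\<pi>. semi_baxter n \<pi>} (active n). g (append_value n s \<pi>))"
    by (rule sum.Sigma) (auto simp: finite_semi_baxter)
  also have "\<dots> = (\<Sum>\<rho> | semi_baxter (Suc n) \<rho>. g \<rho>)"
  proof (rule sum.reindex_bij_witness[where i = "\<lambda>\<rho>. (delete_last n \<rho>, \<rho> (Suc n))"
            and j = "\<lambda>(\<pi>, s). append_value n s \<pi>"], goal_cases)
    case (1 a)
    then show ?case by (auto simp: delete_append semi_baxter_def)
  next
    case (2 a)
    then obtain \<pi> s where a: "a = (\<pi>, s)" "semi_baxter n \<pi>" "s \<in> active n \<pi>" by auto
    then have "\<pi> permutes {1..n}" "s \<in> {1..Suc n}" by (auto simp: semi_baxter_def active_def)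
    from semi_baxter_append_iff[OF this] a show ?case by simp
  next
    case (3 \<rho>)
    then show ?case by (simp add: append_delete semi_baxter_def)
  next
    case (4 \<rho>)
    then have p: "\<rho> permutes {1..Suc n}" by (simp add: semi_baxter_def)
    have "\<rho> (Suc n) \<in> {1..Suc n}" using permutes_in_image[OF p, of "Suc n"] by simp
    from semi_baxter_append_iff[OF delete_last_permutes[OF p] this] append_delete[OF p] 4
    show ?case by simp
  qed auto
  finally show ?thesis by simp
qed

lemma ex_pair_less_Suc:
  "(\<exists>i j. 1 \<le> i \<and> i < j \<and> j < Suc n \<and> P i j) \<longleftrightarrow>
   (\<exists>i j. 1 \<le> i \<and> i < j \<and> j < n \<and> P i j) \<or> (\<exists>i. 1 \<le> i \<and> i < n \<and> P i (n :: nat))"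
  by (auto simp: less_Suc_eq)

text \<open>
Raising the entries keeps their relative order, so an active value not above \<open>s\<close> stays active, and one
that is at least \<open>s\<close> stays active after the shift by one, unless the last two entries create a new
obstruction. They do so if \<open>s < \<pi> n\<close>: then they form a descent, and an earlier entry with a value
between theirs serves as the 2 of a pattern. The entry whose value was \<open>s\<close> is the lowest such one, so
it decides which values become inactive.
\<close>

lemma active_append:
  assumes p: "\<pi> permutes {1..n}" and n: "1 \<le> n" and s: "s \<in> {1..Suc n}"
  shows "t \<le> s \<Longrightarrow> t \<in> active (Suc n) (append_value n s \<pi>) \<longleftrightarrow> t \<in> active n \<pi>"
    and "s \<le> t \<Longrightarrow> Suc t \<in> active (Suc n) (append_value n s \<pi>) \<longleftrightarrow>
           t \<in> active n \<pi> \<and> \<not> (s < t \<and> t \<le> \<pi> n)"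
proof -
  let ?f = "append_value n s \<pi>"
  define old where "old = (\<lambda>t. \<exists>i j. 1 \<le> i \<and> i < j \<and> j < n \<and> \<pi> (j + 1) < \<pi> i \<and> \<pi> i < t \<and> t \<le> \<pi> j)"
  have split: "(\<exists>i j. 1 \<le> i \<and> i < j \<and> j < Suc n \<and> ?f (j + 1) < ?f i \<and> ?f i < t \<and> t \<le> ?f j) \<longleftrightarrow>
     (\<exists>i j. 1 \<le> i \<and> i < j \<and> j < n \<and> \<pi> (j + 1) < \<pi> i \<and> push_above s (\<pi> i) < t \<and> t \<le> push_above s (\<pi> j)) \<or>
     (\<exists>i. 1 \<le> i \<and> i < n \<and> s \<le> \<pi> i \<and> push_above s (\<pi> i) < t \<and> t \<le> push_above s (\<pi> n))"
    (is "?L t \<longleftrightarrow> ?O t \<or> ?N t") for t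
  proof -
    have "?L t \<longleftrightarrow> (\<exists>i j. 1 \<le> i \<and> i < j \<and> j < n \<and> ?f (j + 1) < ?f i \<and> ?f i < t \<and> t \<le> ?f j) \<or>
       (\<exists>i. 1 \<le> i \<and> i < n \<and> ?f (n + 1) < ?f i \<and> ?f i < t \<and> t \<le> ?f n)"
      by (rule ex_pair_less_Suc)
    also have "\<dots> \<longleftrightarrow> ?O t \<or> ?N t"
      using n by (intro arg_cong2[of _ _ _ _ "(\<or>)"] ex_cong1 conj_cong refl) auto
    finally show ?thesis .
  qed
  have act': "t \<in> active (Suc n) ?f \<longleftrightarrow> t \<in> {1..Suc (Suc n)} \<and> \<not> (?O t \<or> ?N t)" for t
    unfolding active_def split[symmetric] by blast
  have act: "t \<in> active n \<pi> \<longleftrightarrow> t \<in> {1..Suc n} \<and> \<not> old t" for t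
    unfolding active_def old_def by blast
  show "t \<in> active (Suc n) ?f \<longleftrightarrow> t \<in> active n \<pi>" if t: "t \<le> s"
  proof -
    have "?O t \<longleftrightarrow> old t" unfolding old_def push_above_small[OF t] ..
    moreover have "\<not> ?N t" unfolding push_above_small[OF t] using t by auto
    ultimately show ?thesis unfolding act' act using t s by auto
  qed
  show "Suc t \<in> active (Suc n) ?f \<longleftrightarrow> t \<in> active n \<pi> \<and> \<not> (s < t \<and> t \<le> \<pi> n)" if t: "s \<le> t"
  proof -
    have "?O (Suc t) \<longleftrightarrow> old t" unfolding old_def push_above_large[OF t] ..
    moreover have "?N (Suc t) \<longleftrightarrow> s < t \<and> t \<le> \<pi> n"
      unfolding push_above_large[OF t]
    proof
      assume "s < t \<and> t \<le> \<pi> n"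
      moreover have "\<pi> n \<in> {1..n}" using permutes_in_image[OF p, of n] n by simp
      ultimately have "s \<in> {1..n}" using s by auto
      then have "s \<in> \<pi> ` {1..n}" using permutes_image[OF p] by simp
      then obtain i where i: "i \<in> {1..n}" "\<pi> i = s" by auto
      with \<open>s < t \<and> t \<le> \<pi> n\<close> have "i \<noteq> n" by auto
      \<comment> \<open>the entry with value \<open>s\<close> lies before the last position and plays the role of the 2\<close>
      then show "\<exists>i. 1 \<le> i \<and> i < n \<and> s \<le> \<pi> i \<and> \<pi> i < t \<and> t \<le> \<pi> n"
        using i \<open>s < t \<and> t \<le> \<pi> n\<close> by (intro exI[of _ i]) auto
    qed auto
    ultimately show ?thesis unfolding act' act using t s by auto
  qed
qed

lemma active_below_append:
  assumes p: "\<pi> permutes {1..n}" and n: "1 \<le> n" and s: "s \<in> active n \<pi>"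
  shows "active_below (Suc n) (append_value n s \<pi>) = card {t \<in> active n \<pi>. t \<le> s}"
proof -
  have "s \<in> {1..Suc n}" using s by (simp add: active_def)
  from active_append(1)[OF p n this]
  have "{t \<in> active (Suc n) (append_value n s \<pi>). t \<le> s} = {t \<in> active n \<pi>. t \<le> s}" by blast
  then show ?thesis by (simp add: active_below_def)
qed

text \<open>
After an ascent no active value is lost. After a descent, the values between the new and the old last
entry become inactive, except for the one directly above the new last entry, which accounts for the
successor.
\<close>

lemma active_above_append:
  assumes p: "\<pi> permutes {1..n}" and n: "1 \<le> n" and s: "s \<in> active n \<pi>"
  shows "active_above (Suc n) (append_value n s \<pi>) =
    (if s \<le> \<pi> n then Suc (active_above n \<pi>) else card {t \<in> active n \<pi>. s \<le> t})"
proof -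
  have s': "s \<in> {1..Suc n}" using s by (simp add: active_def)
  have "{t \<in> active (Suc n) (append_value n s \<pi>). s < t} =
        Suc ` {t \<in> active n \<pi>. s \<le> t \<and> \<not> (s < t \<and> t \<le> \<pi> n)}"
    (is "?L = Suc ` ?R")
  proof (intro equalityI subsetI)
    fix t assume t: "t \<in> ?L"
    then obtain t' where "t = Suc t'" "s \<le> t'" by (cases t) auto
    with t show "t \<in> Suc ` ?R" using active_append(2)[OF p n s', of t'] by auto
  next
    fix t assume "t \<in> Suc ` ?R"
    then show "t \<in> ?L" using active_append(2)[OF p n s'] by auto
  qed
  then have "active_above (Suc n) (append_value n s \<pi>) = card ?R"
    by (simp add: active_above_def card_image)
  also have "\<dots> = (if s \<le> \<pi> n then Suc (active_above n \<pi>) else card {t \<in> active n \<pi>. s \<le> t})"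
  proof (cases "s \<le> \<pi> n")
    case True
    then have "?R = insert s {t \<in> active n \<pi>. \<pi> n < t}" using s by auto
    then show ?thesis using True by (simp add: active_above_def)
  next
    case False
    then have "?R = {t \<in> active n \<pi>. s \<le> t}" by auto
    then show ?thesis using False by simp
  qed
  finally show ?thesis .
qed

section \<open>The succession rule for the labels\<close>

lemma sum_by_rank:
  fixes A :: "'a::linorder set"
  assumes "finite A"
  shows "(\<Sum>s\<in>A. g (card {t \<in> A. t \<le> s})) = (\<Sum>i=1..card A. g i)"
  using assms
proof (induction rule: finite_linorder_max_induct)
  case (insert b A)
  have "{t \<in> insert b A. t \<le> b} = insert b A" using insert.hyps by force
  moreover have "{t \<in> insert b A. t \<le> s} = {t \<in> A. t \<le> s}" if "s \<in> A" for s
    using insert.hyps that by force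
  moreover have "b \<notin> A" using insert.hyps by auto
  ultimately show ?case using insert by (simp add: sum.cl_ivl_Suc add.commute cong: sum.cong)
qed simp

text \<open>
The polynomial \<open>S\<^sub>n(y, z)\<close>, as a function on an arbitrary commutative ring, because it is going to be
evaluated at power series.
\<close>

definition label_poly :: "nat \<Rightarrow> 'a::comm_ring_1 \<Rightarrow> 'a \<Rightarrow> 'a" where
  "label_poly n y z = (\<Sum>\<pi> | semi_baxter n \<pi>. y ^ active_below n \<pi> * z ^ active_above n \<pi>)"

text \<open>
This is the succession rule of the generating tree: among the active values, those up to the last
entry are numbered \<open>i = 1, \<dots>, h\<close> and give the labels \<open>(i, k + 1)\<close>, and those above it are numbered
\<open>i = 1, \<dots>, k\<close> and give the labels \<open>(h + i, k + 1 - i)\<close>.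
\<close>

lemma label_sum_children:
  fixes y z :: "'a::comm_ring_1"
  assumes p: "\<pi> permutes {1..n}" and n: "1 \<le> n"
  defines "h \<equiv> active_below n \<pi>" and "k \<equiv> active_above n \<pi>"
  shows "(\<Sum>s\<in>active n \<pi>. y ^ active_below (Suc n) (append_value n s \<pi>) *
             z ^ active_above (Suc n) (append_value n s \<pi>)) =
         (\<Sum>i=1..h. y ^ i * z ^ Suc k) + (\<Sum>i=1..k. y ^ (h + i) * z ^ (Suc k - i))"
proof -
  define A where "A = {s \<in> active n \<pi>. s \<le> \<pi> n}"
  define B where "B = {s \<in> active n \<pi>. \<pi> n < s}"
  have AB: "active n \<pi> = A \<union> B" "A \<inter> B = {}" "finite A" "finite B"
    by (auto simp: A_def B_def)
  have cA: "card A = h" and cB: "card B = k"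
    by (simp_all add: A_def B_def h_def k_def active_below_def active_above_def)
  let ?g = "\<lambda>s. y ^ active_below (Suc n) (append_value n s \<pi>) *
             z ^ active_above (Suc n) (append_value n s \<pi>)"
  have below: "?g s = y ^ card {t \<in> A. t \<le> s} * z ^ Suc k" if "s \<in> A" for s
  proof -
    have "{t \<in> active n \<pi>. t \<le> s} = {t \<in> A. t \<le> s}" using that by (auto simp: A_def)
    then show ?thesis using that
      by (simp add: A_def active_below_append[OF p n] active_above_append[OF p n] k_def)
  qed
  have above: "?g s = y ^ (h + card {t \<in> B. t \<le> s}) * z ^ (Suc k - card {t \<in> B. t \<le> s})"
    if "s \<in> B" for s
  proof -
    have "{t \<in> active n \<pi>. t \<le> s} = A \<union> {t \<in> B. t \<le> s}" using that by (auto simp: A_def B_def)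
    then have 1: "card {t \<in> active n \<pi>. t \<le> s} = h + card {t \<in> B. t \<le> s}"
      using AB cA by (simp add: card_Un_disjoint disjoint_iff)
    have "insert s B = {t \<in> B. t \<le> s} \<union> {t \<in> B. s < t}" "s \<in> B" using that by auto
    then have "card B = card {t \<in> B. t \<le> s} + card {t \<in> B. s < t}"
      using AB by (subst card_Un_disjoint[symmetric]) (auto simp: insert_absorb)
    moreover have "{t \<in> active n \<pi>. s \<le> t} = insert s {t \<in> B. s < t}"
      using that by (auto simp: B_def)
    then have "card {t \<in> active n \<pi>. s \<le> t} = Suc (card {t \<in> B. s < t})"
      using AB by simp
    ultimately have 2: "card {t \<in> active n \<pi>. s \<le> t} = Suc k - card {t \<in> B. t \<le> s}"
      using cB by simp
    show ?thesis using that 1 2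
      by (simp add: B_def active_below_append[OF p n] active_above_append[OF p n])
  qed
  have "sum ?g (active n \<pi>) = sum ?g A + sum ?g B"
    unfolding AB(1) by (rule sum.union_disjoint) (use AB in auto)
  also have "sum ?g A = (\<Sum>s\<in>A. y ^ card {t \<in> A. t \<le> s} * z ^ Suc k)"
    by (rule sum.cong[OF refl below])
  also have "\<dots> = (\<Sum>i=1..h. y ^ i * z ^ Suc k)"
    using sum_by_rank[OF AB(3), of "\<lambda>i. y ^ i * z ^ Suc k"] cA by simp
  also have "sum ?g B = (\<Sum>s\<in>B. y ^ (h + card {t \<in> B. t \<le> s}) * z ^ (Suc k - card {t \<in> B. t \<le> s}))"
    by (rule sum.cong[OF refl above])
  also have "\<dots> = (\<Sum>i=1..k. y ^ (h + i) * z ^ (Suc k - i))"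
    using sum_by_rank[OF AB(4), of "\<lambda>i. y ^ (h + i) * z ^ (Suc k - i)"] cB by simp
  finally show ?thesis .
qed

lemma geometric_children:
  fixes y z :: "'a::comm_ring_1"
  shows "(1 - y) * (\<Sum>i=1..h. y ^ i) = y * (1 - y ^ h)"
    and "(z - y) * (\<Sum>i=1..k. y ^ i * z ^ (Suc k - i)) = y * z * (z ^ k - y ^ k)"
proof -
  show "(1 - y) * (\<Sum>i=1..h. y ^ i) = y * (1 - y ^ h)"
  proof (induction h)
    case (Suc h)
    have "(\<Sum>i=1..Suc h. y ^ i) = (\<Sum>i=1..h. y ^ i) + y ^ Suc h" by simp
    then show ?case using Suc by (simp add: distrib_left) (simp add: algebra_simps)
  qed simp
  show "(z - y) * (\<Sum>i=1..k. y ^ i * z ^ (Suc k - i)) = y * z * (z ^ k - y ^ k)"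
  proof (induction k)
    case (Suc k)
    have "(\<Sum>i=1..Suc k. y ^ i * z ^ (Suc (Suc k) - i)) =
          z * (\<Sum>i=1..k. y ^ i * z ^ (Suc k - i)) + y ^ Suc k * z"
      by (simp add: sum_distrib_left Suc_diff_le mult_ac)
    moreover have "(z - y) * (z * S + y ^ Suc k * z) = y * z * (z ^ Suc k - y ^ Suc k)"
      if "(z - y) * S = y * z * (z ^ k - y ^ k)" for S
    proof -
      have "(z - y) * (z * S + y ^ Suc k * z) = z * ((z - y) * S) + (z - y) * y ^ Suc k * z"
        by (simp add: algebra_simps)
      then show ?thesis unfolding that by (simp add: algebra_simps)
    qed
    ultimately show ?case using Suc by simp
  qed simp
qed

text \<open>
Summing the two geometric progressions of the succession rule replaces \<open>y\<^sup>h z\<^sup>k\<close> by differences with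
\<open>1\<^sup>h z\<^sup>k\<close> and \<open>y\<^sup>h y\<^sup>k\<close>. Multiplication by \<open>(1 - y) (z - y)\<close> avoids division.
\<close>

lemma label_poly_Suc:
  fixes y z :: "'a::comm_ring_1"
  assumes n: "1 \<le> n"
  shows "(1 - y) * (z - y) * label_poly (Suc n) y z =
    y * z * ((z - y) * (label_poly n 1 z - label_poly n y z) +
             (1 - y) * (label_poly n y z - label_poly n y y))"
proof -
  have "(1 - y) * (z - y) * label_poly (Suc n) y z = (\<Sum>\<pi> | semi_baxter n \<pi>.
     (1 - y) * (z - y) * (\<Sum>s\<in>active n \<pi>. y ^ active_below (Suc n) (append_value n s \<pi>) *
             z ^ active_above (Suc n) (append_value n s \<pi>)))"
    unfolding label_poly_def by (simp add: sum_semi_baxter_Suc sum_distrib_left)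
  also have "\<dots> = (\<Sum>\<pi> | semi_baxter n \<pi>. y * z *
      ((z - y) * (1 ^ active_below n \<pi> * z ^ active_above n \<pi> - y ^ active_below n \<pi> * z ^ active_above n \<pi>) +
       (1 - y) * (y ^ active_below n \<pi> * z ^ active_above n \<pi> - y ^ active_below n \<pi> * y ^ active_above n \<pi>)))"
  proof (rule sum.cong[OF refl])
    fix \<pi> assume "\<pi> \<in> {\<pi>. semi_baxter n \<pi>}"
    then have p: "\<pi> permutes {1..n}" by (simp add: semi_baxter_def)
    define h k where "h = active_below n \<pi>" and "k = active_above n \<pi>"
    have "(1 - y) * (z - y) * ((\<Sum>i=1..h. y ^ i * z ^ Suc k) + (\<Sum>i=1..k. y ^ (h + i) * z ^ (Suc k - i))) =
      (z - y) * z ^ Suc k * ((1 - y) * (\<Sum>i=1..h. y ^ i)) +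
      (1 - y) * y ^ h * ((z - y) * (\<Sum>i=1..k. y ^ i * z ^ (Suc k - i)))"
      by (simp only: distrib_left power_add sum_distrib_left sum_distrib_right mult_ac)
    also have "\<dots> = y * z * ((z - y) * (1 ^ h * z ^ k - y ^ h * z ^ k) + (1 - y) * (y ^ h * z ^ k - y ^ h * y ^ k))"
      unfolding geometric_children by (simp add: algebra_simps)
    finally show "(1 - y) * (z - y) * (\<Sum>s\<in>active n \<pi>. y ^ active_below (Suc n) (append_value n s \<pi>) *
             z ^ active_above (Suc n) (append_value n s \<pi>)) = y * z *
      ((z - y) * (1 ^ active_below n \<pi> * z ^ active_above n \<pi> - y ^ active_below n \<pi> * z ^ active_above n \<pi>) +
       (1 - y) * (y ^ active_below n \<pi> * z ^ active_above n \<pi> - y ^ active_below n \<pi> * y ^ active_above n \<pi>))"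
      unfolding label_sum_children[OF p n] h_def k_def .
  qed
  also have "\<dots> = y * z * ((z - y) * (label_poly n 1 z - label_poly n y z) +
             (1 - y) * (label_poly n y z - label_poly n y y))"
    by (simp only: label_poly_def sum_distrib_left[symmetric] sum.distrib sum_subtractf)
  finally show ?thesis .
qed

lemma label_poly_1: "label_poly 1 y z = y * z"
proof -
  have sb: "{\<pi>. semi_baxter 1 \<pi>} = {id}"
  proof -
    have "semi_baxter 1 \<pi> \<longleftrightarrow> \<pi> = id" for \<pi>
      unfolding semi_baxter_def by (simp add: permutes_sing)
    then show ?thesis by auto
  qed
  have act: "active 1 id = {1, 2}" by (auto simp: active_def)
  have "{s \<in> active 1 id. s \<le> id 1} = {1}" "{s \<in> active 1 id. id 1 < s} = {2}"
    unfolding act by auto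
  then have "active_below 1 id = 1" "active_above 1 id = 1"
    by (simp_all only: active_below_def active_above_def card.empty card_insert_disjoint finite.intros empty_iff not_False_eq_True One_nat_def)
  then show ?thesis unfolding label_poly_def sb by simp
qed

section \<open>Series in a formal power series\<close>

unbundle fps_syntax
notation fls_nth (infixl \<open>$$\<close> 75)

text \<open>
The series \<open>\<Sum> x\<^sup>n g\<^sub>n\<close> for a power series \<open>x\<close> without constant term. The terms with \<open>n > N\<close> do not
contribute to the coefficient of index \<open>N\<close>, so this is a finite definition. It differs from
composition in that the \<open>g\<^sub>n\<close> may themselves be power series.
\<close>

definition series_at :: "'a::comm_ring_1 fps \<Rightarrow> (nat \<Rightarrow> 'a fps) \<Rightarrow> 'a fps" where
  "series_at x g = Abs_fps (\<lambda>N. (\<Sum>n\<le>N. x ^ n * g n) $ N)"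

lemma nth_power_mult_eq_0:
  fixes x :: "'a::comm_ring_1 fps"
  assumes "x $ 0 = 0" and "N < n"
  shows "(x ^ n * g) $ N = 0"
  using startsby_zero_power_prefix[OF assms(1)] assms(2) by (auto simp: fps_mult_nth)

lemma series_at_nth:
  fixes x :: "'a::comm_ring_1 fps"
  assumes x: "x $ 0 = 0" and "N \<le> M"
  shows "series_at x g $ N = (\<Sum>n\<le>M. x ^ n * g n) $ N"
  unfolding series_at_def fps_nth_Abs_fps fps_sum_nth
  by (rule sum.mono_neutral_left) (use assms nth_power_mult_eq_0[OF x] in auto)

lemma series_at_mult:
  fixes x :: "'a::comm_ring_1 fps"
  assumes x: "x $ 0 = 0"
  shows "series_at x (\<lambda>n. c * g n) = c * series_at x g"
proof (rule fps_ext)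
  fix N
  have "(c * series_at x g) $ N = (c * (\<Sum>n\<le>N. x ^ n * g n)) $ N"
    unfolding fps_mult_nth by (rule sum.cong[OF refl]) (simp add: series_at_nth[OF x, where M = N])
  then show "series_at x (\<lambda>n. c * g n) $ N = (c * series_at x g) $ N"
    by (simp add: series_at_def sum_distrib_left mult_ac)
qed

lemma series_at_add: "series_at x (\<lambda>n. f n + g n) = series_at x f + series_at x g"
  by (rule fps_ext) (simp add: series_at_def distrib_left sum.distrib fps_sum_nth)

lemma series_at_diff: "series_at x (\<lambda>n. f n - g n) = series_at x f - series_at x g"
  by (rule fps_ext) (simp add: series_at_def right_diff_distrib sum_subtractf fps_sum_nth)

lemma series_at_Suc:
  fixes x :: "'a::comm_ring_1 fps"
  assumes x: "x $ 0 = 0"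
  shows "series_at x g = g 0 + x * series_at x (\<lambda>n. g (Suc n))"
proof (rule fps_ext)
  fix N
  have "(x * series_at x (\<lambda>n. g (Suc n))) $ N = (x * (\<Sum>n\<le>N. x ^ n * g (Suc n))) $ N"
    unfolding fps_mult_nth by (rule sum.cong[OF refl]) (simp add: series_at_nth[OF x, where M = N])
  moreover have "series_at x g $ N = (\<Sum>n\<le>Suc N. x ^ n * g n) $ N"
    by (rule series_at_nth[OF x]) simp
  moreover have "(\<Sum>n\<le>Suc N. x ^ n * g n) = g 0 + x * (\<Sum>n\<le>N. x ^ n * g (Suc n))"
    by (simp only: sum.atMost_Suc_shift) (simp add: sum_distrib_left mult_ac)
  ultimately show "series_at x g $ N = (g 0 + x * series_at x (\<lambda>n. g (Suc n))) $ N"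
    by (simp only: fps_add_nth)
qed

section \<open>Lagrange inversion\<close>

text \<open>
The coefficient of index \<open>j\<close> of \<open>\<phi>\<^sup>j \<phi>'\<close> is that of \<open>(\<phi>\<^sup>j\<^sup>+\<^sup>1)' / (j + 1)\<close>, which is the coefficient of
index \<open>j + 1\<close> of \<open>\<phi>\<^sup>j\<^sup>+\<^sup>1\<close>; characteristic zero permits cancelling \<open>j + 1\<close>.
\<close>

lemma lagrange_power:
  fixes \<phi> :: "'a::{idom,ring_char_0} fps"
  shows "(\<phi> ^ j * (\<phi> - fps_X * fps_deriv \<phi>)) $ Suc j = 0"
proof -
  have "fps_deriv (\<phi> ^ Suc j) = of_nat (Suc j) * (\<phi> ^ j * fps_deriv \<phi>)"
    by (simp only: fps_deriv_power' diff_Suc_1 mult_ac)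
  then have "of_nat (Suc j) * (\<phi> ^ j * fps_deriv \<phi>) $ j = fps_deriv (\<phi> ^ Suc j) $ j"
    by (simp only: fps_mult_of_nat_nth)
  also have "\<dots> = of_nat (Suc j) * (\<phi> ^ Suc j) $ Suc j"
    by (simp only: fps_deriv_nth Suc_eq_plus1)
  finally have "(\<phi> ^ j * fps_deriv \<phi>) $ j = (\<phi> ^ Suc j) $ Suc j"
    by (simp del: of_nat_Suc power_Suc)
  moreover have "\<phi> ^ j * (\<phi> - fps_X * fps_deriv \<phi>) = \<phi> ^ Suc j - fps_X * (\<phi> ^ j * fps_deriv \<phi>)"
    by (simp add: algebra_simps)
  ultimately show ?thesis by (simp del: power_Suc)
qed

text \<open>
Lagrange inversion in the form in which the series is given in the variable \<open>u\<close> with \<open>u = x \<phi>(u)\<close>, and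
its expansion in powers of \<open>x\<close> is sought. By linearity it suffices to see that multiplying \<open>x\<^sup>k\<close> by
\<open>\<phi>\<^sup>m (\<phi> - u \<phi>')\<close> produces a term of degree \<open>m + 1\<close> only for \<open>k = m + 1\<close>.
\<close>

lemma lagrange_inversion:
  fixes \<phi> x :: "'a::{idom,ring_char_0} fps"
  assumes x: "x $ 0 = 0" and inv: "x * \<phi> = fps_X"
  shows "(series_at x (\<lambda>n. fps_const (s n)) * (\<phi> ^ m * (\<phi> - fps_X * fps_deriv \<phi>))) $ Suc m = s (Suc m)"
proof -
  let ?D = "\<phi> - fps_X * fps_deriv \<phi>"
  \<comment> \<open>for \<open>k \<le> m\<close> cancel \<open>(x \<phi>)\<^sup>k = u\<^sup>k\<close> and use the vanishing coefficient above\<close>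
  have low: "(x ^ k * (\<phi> ^ m * ?D)) $ Suc m = 0" if "k \<le> m" for k
  proof -
    have "\<phi> ^ m = \<phi> ^ k * \<phi> ^ (m - k)" using that by (simp flip: power_add)
    then have "x ^ k * (\<phi> ^ m * ?D) = (x * \<phi>) ^ k * (\<phi> ^ (m - k) * ?D)"
      by (simp only: power_mult_distrib mult_ac)
    then show ?thesis using lagrange_power[of \<phi> "m - k"] that
      by (simp only: inv fps_X_power_mult_nth) (simp add: Suc_diff_le)
  qed
  \<comment> \<open>for \<open>k = m + 1\<close> the product starts with \<open>u\<^sup>m\<^sup>+\<^sup>1\<close>\<close>
  have "x ^ Suc m * (\<phi> ^ m * ?D) = (x * \<phi>) ^ m * (x * \<phi> - fps_X * (x * fps_deriv \<phi>))"
    by (simp only: power_Suc power_mult_distrib right_diff_distrib mult_ac)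
  also have "\<dots> = fps_X ^ Suc m * (1 - x * fps_deriv \<phi>)"
    unfolding inv by (simp add: algebra_simps)
  finally have top: "(x ^ Suc m * (\<phi> ^ m * ?D)) $ Suc m = 1"
    using x by (simp only: fps_X_power_mult_nth) simp
  have "series_at x (\<lambda>n. fps_const (s n)) * (\<phi> ^ m * ?D) =
        series_at x (\<lambda>n. fps_const (s n) * (\<phi> ^ m * ?D))"
    using series_at_mult[OF x, of "\<phi> ^ m * ?D" "\<lambda>n. fps_const (s n)"] by (simp add: mult.commute)
  also have "\<dots> $ Suc m = (\<Sum>k\<le>Suc m. (fps_const (s k) * (x ^ k * (\<phi> ^ m * ?D))) $ Suc m)"
    by (simp add: series_at_def fps_sum_nth mult.left_commute del: sum.atMost_Suc)
  also have "\<dots> = (\<Sum>k\<le>Suc m. s k * (x ^ k * (\<phi> ^ m * ?D)) $ Suc m)"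
    by (simp only: fps_mult_left_const_nth)
  also have "\<dots> = s (Suc m)" using low top by simp
  finally show ?thesis .
qed

section \<open>The kernel method\<close>

text \<open>
In the functional equation of the generating function, all terms with \<open>S(y, z)\<close> carry the factor
\<open>(1 - y) (z - y) + x y z (z - 1)\<close>. It vanishes on the curve given by \<open>kernel\<close>, which leaves a relation
between the two unknowns of one variable.
\<close>

lemma kernel_relation:
  fixes x y z :: "'a::idom fps"
  assumes x: "x $ 0 = 0" and nz: "y \<noteq> 0" "z \<noteq> 0"
    and kernel: "x * y * z * (z - 1) = (y - 1) * (z - y)"
  shows "(y - 1) * (x * series_at x (\<lambda>n. label_poly (Suc n) y y) - (z - y)) +
         (z - y) * (x * series_at x (\<lambda>n. label_poly (Suc n) 1 z)) = 0"
proof -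
  define E where "E = series_at x (\<lambda>n. label_poly (Suc n) y z)"
  define U where "U = series_at x (\<lambda>n. label_poly (Suc n) y y)"
  define V where "V = series_at x (\<lambda>n. label_poly (Suc n) 1 z)"
  have "(1 - y) * (z - y) * E =
      (1 - y) * (z - y) * (y * z) + x * series_at x (\<lambda>n. (1 - y) * (z - y) * label_poly (Suc (Suc n)) y z)"
    unfolding E_def series_at_mult[OF x]
    by (subst series_at_Suc[OF x]) (simp add: label_poly_1[unfolded One_nat_def] algebra_simps)
  also have "series_at x (\<lambda>n. (1 - y) * (z - y) * label_poly (Suc (Suc n)) y z) =
      series_at x (\<lambda>n. y * z * ((z - y) * (label_poly (Suc n) 1 z - label_poly (Suc n) y z) +
             (1 - y) * (label_poly (Suc n) y z - label_poly (Suc n) y y)))"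
    by (subst label_poly_Suc) simp_all
  also have "\<dots> = y * z * ((z - y) * (V - E) + (1 - y) * (E - U))"
    unfolding series_at_mult[OF x] series_at_add series_at_diff E_def U_def V_def ..
  finally have "y * z * ((1 - y) * (z - y) + x * (z - y) * V - x * (1 - y) * U) =
      E * ((1 - y) * (z - y) + x * y * z * (z - 1))"
    by (simp add: algebra_simps)
  also have "(1 - y) * (z - y) + x * y * z * (z - 1) = 0"
    unfolding kernel by (simp add: algebra_simps)
  finally have "(1 - y) * (z - y) + x * (z - y) * V - x * (1 - y) * U = 0"
    using nz by simp
  then show ?thesis unfolding U_def V_def by (simp add: algebra_simps)
qed

text \<open>
The hypotheses \<open>R1\<close> to \<open>R5\<close> are the relations at five successive points of the orbit, up to common
factors. Each shares one unknown with its neighbour, so substituting them one after the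
other leaves only the first and the last unknown. Here \<open>a'\<close> and \<open>b'\<close> stand for the inverses of \<open>a\<close> and
\<open>b\<close>, while the denominators \<open>\<alpha>\<close> and \<open>\<beta>\<close> are cleared by the factor \<open>\<alpha> \<beta>\<^sup>2\<close>.
\<close>

lemma kernel_elimination:
  fixes a a' b b' x u \<alpha> \<beta> U U1 U2 V V1 V2 d :: "'a::idom"
  assumes inv: "a * a' = 1" "b * b' = 1"
    and x: "x * b * \<beta> * \<alpha> = a * u"
    and d: "\<beta> * d = a' * b"
    and R1: "a * (U - u) + u * V = 0"
    and R2: "u * (U1 - \<beta> * a * b') + \<beta> * a * V = 0"
    and R3: "U1 - u * a' * b' + a' * V1 = 0"
    and R4: "U2 - x * b * \<alpha>\<^sup>2 * a'\<^sup>2 + \<alpha> * V1 = 0"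
    and R5: "x * b * \<alpha> * a'\<^sup>2 * (U2 - d) + d * V2 = 0"
  shows "\<alpha> * \<beta>\<^sup>2 * (U + x * b\<^sup>2 * a' ^ 4 * V2) =
    u * \<alpha> * \<beta>\<^sup>2 - u\<^sup>2 * a' * b' * \<alpha> * \<beta>\<^sup>2
    + u ^ 3 * a' ^ 3 * b' * \<alpha> * \<beta> - u ^ 3 * a' ^ 4 * \<alpha> + u\<^sup>2 * a' ^ 4 * b"
proof -
  have 1: "U = u - u * a' * V"
  proof -
    have "0 = (a * a') * (U - u) + u * a' * V"
      using arg_cong[OF R1, of "(*) a'"] by (simp add: algebra_simps)
    then show ?thesis unfolding inv by (simp add: algebra_simps)
  qed
  have 2: "\<beta> * V = u * \<beta> * b' - u * a' * U1"
  proof -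
    have "0 = u * a' * U1 - (a * a') * (u * \<beta> * b') + (a * a') * (\<beta> * V)"
      using arg_cong[OF R2, of "(*) a'"] by (simp add: algebra_simps)
    then show ?thesis unfolding inv by (simp add: algebra_simps)
  qed
  have 3: "U1 = u * a' * b' - a' * V1" using R3 by (simp add: algebra_simps)
  have 4: "\<alpha> * V1 = x * b * \<alpha>\<^sup>2 * a'\<^sup>2 - U2" using R4 by (simp add: algebra_simps)
  have 5: "x * b * \<alpha> * a'\<^sup>2 * U2 = d * (x * b * \<alpha> * a'\<^sup>2 - V2)" using R5 by (simp add: algebra_simps)
  \<comment> \<open>powers of \<open>a'\<close> absorb the factors \<open>a\<close> that the relation \<open>x\<close> produces\<close>
  have a5: "a' ^ 5 * (a * w) = a' ^ 4 * w" and a4: "a' ^ 4 * (a * w) = a' ^ 3 * w" for w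
  proof -
    have "a' ^ Suc k * (a * w) = (a * a') * (a' ^ k * w)" for k by (simp add: mult_ac)
    from this[of 4] this[of 3] show "a' ^ 5 * (a * w) = a' ^ 4 * w" "a' ^ 4 * (a * w) = a' ^ 3 * w"
      unfolding inv by simp_all
  qed
  have 6: "u\<^sup>2 * \<beta> * a' ^ 3 * U2 = u\<^sup>2 * a' ^ 4 * b - u * a' ^ 3 * b * \<beta> * V2"
  proof -
    have "u\<^sup>2 * \<beta> * a' ^ 3 * U2 = a' ^ 4 * (a * u) * (u * \<beta> * U2)"
      unfolding a4 by (simp add: power2_eq_square mult_ac)
    also have "\<dots> = u * a'\<^sup>2 * \<beta>\<^sup>2 * (x * b * \<alpha> * a'\<^sup>2 * U2)"
      unfolding x[symmetric] by (simp add: eval_nat_numeral mult_ac)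
    also have "\<dots> = u * a'\<^sup>2 * \<beta> * (\<beta> * d) * (x * b * \<alpha> * a'\<^sup>2 - V2)"
      unfolding 5 by (simp add: power2_eq_square mult_ac)
    also have "\<dots> = a' ^ 5 * (x * b * \<beta> * \<alpha>) * u * b - u * a' ^ 3 * b * \<beta> * V2"
      unfolding d by (simp add: eval_nat_numeral algebra_simps)
    also have "\<dots> = u\<^sup>2 * a' ^ 4 * b - u * a' ^ 3 * b * \<beta> * V2"
      unfolding x a5 by (simp add: power2_eq_square mult_ac)
    finally show ?thesis .
  qed
  have "\<alpha> * \<beta>\<^sup>2 * U = u * \<alpha> * \<beta>\<^sup>2 - u * a' * \<alpha> * \<beta> * (\<beta> * V)"
    unfolding 1 by (simp add: power2_eq_square algebra_simps)
  also have "\<dots> = u * \<alpha> * \<beta>\<^sup>2 - u\<^sup>2 * a' * b' * \<alpha> * \<beta>\<^sup>2 + u\<^sup>2 * a'\<^sup>2 * \<alpha> * \<beta> * U1"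
    unfolding 2 by (simp add: power2_eq_square algebra_simps)
  also have "u\<^sup>2 * a'\<^sup>2 * \<alpha> * \<beta> * U1 = u ^ 3 * a' ^ 3 * b' * \<alpha> * \<beta> - u\<^sup>2 * a' ^ 3 * \<beta> * (\<alpha> * V1)"
    unfolding 3 by (simp add: eval_nat_numeral algebra_simps)
  also have "u\<^sup>2 * a' ^ 3 * \<beta> * (\<alpha> * V1) =
      a' ^ 5 * (x * b * \<beta> * \<alpha>) * u\<^sup>2 * \<alpha> - u\<^sup>2 * \<beta> * a' ^ 3 * U2"
    unfolding 4 by (simp add: eval_nat_numeral algebra_simps)
  also have "\<dots> = u ^ 3 * a' ^ 4 * \<alpha> - (u\<^sup>2 * a' ^ 4 * b - u * a' ^ 3 * b * \<beta> * V2)"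
    unfolding x a5 6 by (simp add: eval_nat_numeral mult_ac)
  finally have U: "\<alpha> * \<beta>\<^sup>2 * U = u * \<alpha> * \<beta>\<^sup>2 - u\<^sup>2 * a' * b' * \<alpha> * \<beta>\<^sup>2
    + (u ^ 3 * a' ^ 3 * b' * \<alpha> * \<beta> - (u ^ 3 * a' ^ 4 * \<alpha> - (u\<^sup>2 * a' ^ 4 * b - u * a' ^ 3 * b * \<beta> * V2)))" .
  have "\<alpha> * \<beta>\<^sup>2 * (x * b\<^sup>2 * a' ^ 4 * V2) = a' ^ 4 * (x * b * \<beta> * \<alpha>) * b * \<beta> * V2"
    by (simp add: power2_eq_square mult_ac)
  also have "\<dots> = u * a' ^ 3 * b * \<beta> * V2"
    unfolding x a4 by (simp add: mult_ac)
  finally show ?thesis using U by (simp add: distrib_left)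
qed

lemma one_plus_fls_X_nonzero: "(1 + fls_X :: real fls) \<noteq> 0"
proof
  assume "(1 + fls_X :: real fls) = 0"
  then have "(1 + fls_X :: real fls) $$ 0 = 0" by simp
  then show False by simp
qed

text \<open>
The five points are \<open>(b, \<beta>)\<close>, \<open>(y1, \<beta>)\<close>, \<open>(y1, z1)\<close>, \<open>(y2, z1)\<close> and \<open>(y2, b a')\<close>, where \<open>y1 = \<beta> / b\<close>,
\<open>z1 = (\<beta> - 1) / a\<close> and \<open>y2 = z1 / y1\<close>, and the last second coordinate is \<open>1 + 1/a\<close>. They lie on the
kernel curve and are reached from \<open>(b, \<beta>)\<close> by applying the involutions \<open>y \<mapsto> z / y\<close> and
\<open>z \<mapsto> y (z - 1) / (z - y)\<close> in turn. That all their coordinates are power series in \<open>u\<close> is what makes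
the substitution into the generating functions possible.
\<close>

lemma orbit_relations:
  fixes x :: "real fls fps"
  defines "a \<equiv> fps_const fls_X" and "a' \<equiv> fps_const (inverse fls_X)"
    and "b \<equiv> fps_const (1 + fls_X)" and "b' \<equiv> fps_const (inverse (1 + fls_X))"
    and "U \<equiv> \<lambda>y. x * series_at x (\<lambda>n. label_poly (Suc n) y y)"
    and "V \<equiv> \<lambda>z. x * series_at x (\<lambda>n. label_poly (Suc n) 1 z)"
  assumes x0: "x $ 0 = 0" and x: "x * b * (fps_X + b) * (fps_X + a) = a * fps_X"
  shows "(fps_X + a) * (fps_X + b)\<^sup>2 * (U b + x * b\<^sup>2 * a' ^ 4 * V (b * a')) =
    fps_X * (fps_X + a) * (fps_X + b)\<^sup>2 - fps_X\<^sup>2 * a' * b' * (fps_X + a) * (fps_X + b)\<^sup>2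
    + fps_X ^ 3 * a' ^ 3 * b' * (fps_X + a) * (fps_X + b)
    - fps_X ^ 3 * a' ^ 4 * (fps_X + a) + fps_X\<^sup>2 * a' ^ 4 * b"
proof -
  define \<alpha> \<beta> u where "\<alpha> = fps_X + a" and "\<beta> = fps_X + b" and "u = (fps_X :: real fls fps)"
  have inv: "a * a' = 1" "b * b' = 1" unfolding a_def a'_def b_def b'_def using one_plus_fls_X_nonzero by simp_all
  have ba: "b = 1 + a" unfolding a_def b_def by (simp flip: fps_const_add)
  have nz: "a \<noteq> 0" "b \<noteq> 0" "u \<noteq> 0" "a' \<noteq> 0" "b' \<noteq> 0" using inv by (auto simp: u_def)
  have \<beta>u: "\<beta> = b + u" and \<alpha>\<beta>: "\<alpha> = \<beta> - 1" and \<alpha>u: "\<alpha> = a + u"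
    by (simp_all add: \<alpha>_def \<beta>_def ba u_def)
  have x': "x * b * \<beta> * \<alpha> = a * u" using x by (simp add: \<alpha>_def \<beta>_def u_def)
  with nz have nz': "\<alpha> \<noteq> 0" "\<beta> \<noteq> 0" "x \<noteq> 0" by auto
  have bb': "1 - b' = a * b'" using inv(2) unfolding ba by (simp add: algebra_simps)
  have ab': "a' - b' = a' * b'"
  proof -
    have "a' - b' = a' * (b * b') - b' * (a * a')" using inv by simp
    also have "\<dots> = a' * b'" unfolding ba by (simp add: algebra_simps)
    finally show ?thesis .
  qed
  have ba': "b * a' = 1 + a'" unfolding ba using inv by (simp add: algebra_simps)
  define y1 z1 y2 d where "y1 = \<beta> * b'" and "z1 = \<alpha> * a'"
    and "y2 = 1 + x * b * \<alpha> * a'\<^sup>2" and "d = b * a' - y2"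
  have y1: "y1 - 1 = u * b'" "\<beta> - y1 = \<beta> * a * b'"
  proof -
    have "y1 = b * b' + u * b'" by (simp add: y1_def \<beta>u algebra_simps)
    then show "y1 - 1 = u * b'" unfolding inv by simp
    have "\<beta> - y1 = \<beta> * (1 - b')" by (simp add: y1_def algebra_simps)
    then show "\<beta> - y1 = \<beta> * a * b'" unfolding bb' by (simp add: mult_ac)
  qed
  have z1: "z1 - 1 = u * a'" "z1 - y1 = u * a' * b'"
  proof -
    have "z1 = a * a' + u * a'" by (simp add: z1_def \<alpha>u algebra_simps)
    then show e: "z1 - 1 = u * a'" unfolding inv by simp
    have "z1 - y1 = (z1 - 1) - (y1 - 1)" by simp
    also have "\<dots> = u * (a' - b')" unfolding e y1 by (simp add: algebra_simps)
    finally show "z1 - y1 = u * a' * b'" unfolding ab' by (simp add: mult_ac)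
  qed
  have u: "u = x * b * \<beta> * \<alpha> * a'" unfolding x' using inv by (simp add: mult_ac)
  have y2: "y2 - 1 = x * b * \<alpha> * a'\<^sup>2" "z1 - y2 = x * b * \<alpha>\<^sup>2 * a'\<^sup>2"
  proof -
    show e: "y2 - 1 = x * b * \<alpha> * a'\<^sup>2" by (simp add: y2_def)
    have "z1 - y2 = (z1 - 1) - (y2 - 1)" by simp
    also have "\<dots> = x * b * \<beta> * \<alpha> * a' * a' - x * b * \<alpha> * a'\<^sup>2" unfolding e z1 by (subst u) simp
    also have "\<dots> = x * b * \<alpha>\<^sup>2 * a'\<^sup>2" unfolding \<alpha>\<beta> by (simp add: power2_eq_square algebra_simps)
    finally show "z1 - y2 = x * b * \<alpha>\<^sup>2 * a'\<^sup>2" .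
  qed
  have y2\<beta>: "y2 * \<beta> = b * \<alpha> * a'"
  proof -
    have "y2 * \<beta> = \<beta> + x * b * \<beta> * \<alpha> * a' * a'" by (simp add: y2_def power2_eq_square algebra_simps)
    also have "\<dots> = b + u + u * a'" unfolding u[symmetric] by (simp add: \<beta>u)
    also have "\<dots> = b * (a * a') + u * (a * a' + a')" unfolding inv by (simp add: algebra_simps)
    also have "\<dots> = b * \<alpha> * a'" unfolding \<alpha>u ba by (simp add: algebra_simps)
    finally show ?thesis .
  qed
  have d: "\<beta> * d = a' * b"
  proof -
    have "\<beta> * d = \<beta> * b * a' - y2 * \<beta>" by (simp add: d_def algebra_simps)
    then show ?thesis unfolding y2\<beta> \<alpha>\<beta> by (simp add: algebra_simps)
  qed
  have x\<beta>\<alpha>: "x * \<beta> * \<alpha> = a * u * b'"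
  proof -
    have "x * \<beta> * \<alpha> = (b * b') * (x * \<beta> * \<alpha>)" unfolding inv by simp
    also have "\<dots> = (x * b * \<beta> * \<alpha>) * b'" by (simp add: mult_ac)
    finally show ?thesis unfolding x' .
  qed
  \<comment> \<open>the coordinates have to be nonzero, as the kernel relation divides by them\<close>
  have nz'': "y1 \<noteq> 0" "z1 \<noteq> 0" "b * a' \<noteq> 0" using nz nz' by (simp_all add: y1_def z1_def)
  have "y2 * \<beta> \<noteq> 0" unfolding y2\<beta> using nz nz' by simp
  then have "y2 \<noteq> 0" by auto
  have R1: "a * (U b - u) + u * V \<beta> = 0"
  proof -
    have "x * b * \<beta> * (\<beta> - 1) = (b - 1) * (\<beta> - b)"
      using x' by (simp add: \<alpha>\<beta> ba \<beta>u)
    from kernel_relation[OF x0 _ _ this] nz nz' show ?thesis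
      by (simp add: U_def V_def ba \<beta>u)
  qed
  have R2: "u * (U y1 - \<beta> * a * b') + \<beta> * a * V \<beta> = 0"
  proof -
    have "x * y1 * \<beta> * (\<beta> - 1) = \<beta> * b' * (x * \<beta> * \<alpha>)" by (simp add: y1_def \<alpha>\<beta> mult_ac)
    also have "\<dots> = (y1 - 1) * (\<beta> - y1)" unfolding x\<beta>\<alpha> y1 by (simp add: mult_ac)
    finally have "x * y1 * \<beta> * (\<beta> - 1) = (y1 - 1) * (\<beta> - y1)" .
    from kernel_relation[OF x0 nz''(1) nz'(2) this]
    have "b' * (u * (U y1 - \<beta> * a * b') + \<beta> * a * V \<beta>) = 0"
      unfolding y1 U_def V_def by (simp add: algebra_simps)
    then show ?thesis using nz by simp
  qed
  have R3: "U y1 - u * a' * b' + a' * V z1 = 0"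
  proof -
    have "x * y1 * z1 * (z1 - 1) = u * b' * a' * a' * (x * \<beta> * \<alpha>)"
      unfolding z1 by (simp add: y1_def z1_def mult_ac)
    also have "\<dots> = u * b' * (u * a' * b') * (a * a')" unfolding x\<beta>\<alpha> by (simp add: mult_ac)
    finally have "x * y1 * z1 * (z1 - 1) = (y1 - 1) * (z1 - y1)" unfolding inv y1 z1 by simp
    from kernel_relation[OF x0 nz''(1,2) this]
    have "(u * b') * (U y1 - u * a' * b' + a' * V z1) = 0"
      unfolding y1 z1 U_def V_def by (simp add: algebra_simps)
    then show ?thesis using nz by simp
  qed
  have R4: "U y2 - x * b * \<alpha>\<^sup>2 * a'\<^sup>2 + \<alpha> * V z1 = 0"
  proof -
    have "\<beta> * (x * y2 * z1 * (z1 - 1)) = x * \<alpha> * a' * u * a' * (y2 * \<beta>)"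
      unfolding z1 by (simp add: z1_def mult_ac)
    also have "\<dots> = x * b * \<alpha>\<^sup>2 * a' ^ 3 * u * (a * a')"
      unfolding y2\<beta> inv by (simp add: eval_nat_numeral mult_ac)
    also have "\<dots> = x * b * \<alpha>\<^sup>2 * a' ^ 4 * (x * b * \<beta> * \<alpha>)"
      unfolding x' by (simp add: eval_nat_numeral mult_ac)
    also have "\<dots> = \<beta> * ((y2 - 1) * (z1 - y2))"
      unfolding y2 by (simp add: eval_nat_numeral mult_ac)
    finally have "x * y2 * z1 * (z1 - 1) = (y2 - 1) * (z1 - y2)" using nz' by simp
    from kernel_relation[OF x0 \<open>y2 \<noteq> 0\<close> nz''(2) this]
    have "(x * b * \<alpha> * a'\<^sup>2) * (U y2 - x * b * \<alpha>\<^sup>2 * a'\<^sup>2 + \<alpha> * V z1) = 0"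
      unfolding y2 U_def V_def by (simp add: power2_eq_square algebra_simps)
    then show ?thesis using nz nz' by simp
  qed
  have R5: "x * b * \<alpha> * a'\<^sup>2 * (U y2 - d) + d * V (b * a') = 0"
  proof -
    have "b * a' - 1 = a'" by (simp add: ba')
    then have "\<beta> * (x * y2 * (b * a') * (b * a' - 1)) = x * b * a' * a' * (y2 * \<beta>)"
      by (simp only: mult_ac)
    also have "\<dots> = x * b * \<alpha> * a'\<^sup>2 * (\<beta> * d)"
      unfolding y2\<beta> d by (simp add: power2_eq_square mult_ac)
    also have "\<dots> = \<beta> * ((y2 - 1) * (b * a' - y2))"
      unfolding y2 by (simp add: d_def mult_ac)
    finally have "x * y2 * (b * a') * (b * a' - 1) = (y2 - 1) * (b * a' - y2)" using nz' by simp
    from kernel_relation[OF x0 \<open>y2 \<noteq> 0\<close> nz''(3) this] show ?thesis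
      unfolding y2 U_def V_def by (simp add: d_def)
  qed
  from kernel_elimination[OF inv x' d R1 R2 R3 R4 R5] show ?thesis
    unfolding \<alpha>_def \<beta>_def u_def .
qed

section \<open>Extracting the constant term\<close>

lemma fps_const_sum: "fps_const (\<Sum>i\<in>A. f i) = (\<Sum>i\<in>A. fps_const (f i))"
  by (rule fps_ext) (simp add: fps_sum_nth)

lemma fls_nth_sum: "(\<Sum>i\<in>A. f i) $$ k = (\<Sum>i\<in>A. f i $$ k)"
  by (induction A rule: infinite_finite_induct) simp_all

lemma label_poly_const:
  "label_poly n (fps_const y) (fps_const z) = fps_const (label_poly n y z)"
  by (simp add: label_poly_def fps_const_sum)

lemma label_poly_const_1:
  "label_poly n 1 (fps_const z) = fps_const (label_poly n 1 z)"
  using label_poly_const[of n 1 z] by simp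

text \<open>
The reciprocal factorial, with value \<open>0\<close> at the poles of the factorial, so that the recurrence
\<open>1 / (k - 1)! = k / k!\<close> holds for all integers.
\<close>

definition inv_fact :: "int \<Rightarrow> real" where
  "inv_fact k = (if k < 0 then 0 else 1 / fact (nat k))"

lemma inv_fact_neg [simp]: "k < 0 \<Longrightarrow> inv_fact k = 0"
  by (simp add: inv_fact_def)

lemma inv_fact_pred: "inv_fact (k - 1) = of_int k * inv_fact k"
proof (cases "k \<le> 0")
  case False
  then obtain m where "k = int (Suc m)" by (metis gr0_implies_Suc not_le zero_less_imp_eq_int)
  moreover have "1 / fact m = real (Suc m) * (1 / fact (Suc m))"
    by (simp add: fact_Suc del: of_nat_Suc)
  ultimately show ?thesis by (simp add: inv_fact_def nat_add_distrib)
qed (auto simp: inv_fact_def)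

definition int_binomial :: "int \<Rightarrow> int \<Rightarrow> real" where
  "int_binomial m k = fact (nat m) * inv_fact k * inv_fact (m - k)"

lemma int_binomial_of_nat: "int_binomial (int m) (int k) = real (m choose k)"
proof (cases "k \<le> m")
  case True
  then show ?thesis
    by (simp add: int_binomial_def inv_fact_def binomial_fact nat_diff_distrib flip: of_nat_diff)
qed (simp add: int_binomial_def binomial_eq_0)

text \<open>
The constant term is the coefficient of index \<open>q - e\<close> of \<open>(1 + a)\<^sup>p\<close>.
\<close>

lemma laurent_constant_term:
  "(inverse fls_X ^ q * fls_X ^ e * (1 + fls_X) ^ p :: real fls) $$ 0 = int_binomial (int p) (int q - int e)"
proof -
  have "(inverse fls_X ^ q * fls_X ^ e * (1 + fls_X) ^ p :: real fls) =
        fls_X_intpow (int e - int q) * fps_to_fls ((1 + fps_X) ^ p)"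
    by (simp add: fls_inverse_X fls_X_inv_power_conv_shift_1 fls_X_power_conv_shift_1
        fls_X_intpow_times_fls_X_intpow[of "- int q" "int e", simplified] fps_to_fls_power)
  then have "(inverse fls_X ^ q * fls_X ^ e * (1 + fls_X) ^ p :: real fls) $$ 0 =
        fps_to_fls ((1 + fps_X) ^ p) $$ (int q - int e)"
    by (simp add: fls_shifted_times_simps)
  also have "\<dots> = int_binomial (int p) (int q - int e)"
  proof (cases "e \<le> q")
    case True
    have "(1 + fps_X :: real fps) ^ p $ (q - e) = real (p choose (q - e))"
      by (simp flip: fps_binomial_of_nat add: binomial_gbinomial)
    then show ?thesis using True int_binomial_of_nat[of p "q - e"]
      by (simp add: nat_diff_distrib of_nat_diff)
  qed (simp add: int_binomial_def)
  finally show ?thesis .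
qed

text \<open>
At \<open>a = 0\<close> both arguments become \<open>1\<close>, and the polynomial counts the permutations.
\<close>

lemma label_poly_diagonal_constant_term:
  "label_poly n (1 + fls_X) (1 + fls_X :: real fls) $$ 0 = real (SB n)"
proof -
  have "((1 + fls_X) ^ h * (1 + fls_X) ^ k :: real fls) $$ 0 = 1" for h k
    using laurent_constant_term[of 0 0 "h + k"] int_binomial_of_nat[of "h + k" 0] by (simp add: power_add)
  then show ?thesis by (simp add: label_poly_def fls_nth_sum SB_def)
qed

text \<open>
Every monomial is \<open>(1 + a)\<^sup>k\<^sup>+\<^sup>2 / a\<^sup>k\<^sup>+\<^sup>4\<close>, in which all exponents of \<open>a\<close> are at most \<open>-2\<close>.
\<close>

lemma label_poly_reflected_constant_term:
  "((1 + fls_X)\<^sup>2 * inverse fls_X ^ 4 * label_poly n 1 ((1 + fls_X) * inverse fls_X) :: real fls) $$ 0 = 0"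
proof -
  have "((1 + fls_X)\<^sup>2 * inverse fls_X ^ 4 * ((1 + fls_X) * inverse fls_X) ^ k :: real fls) $$ 0 = 0" for k
  proof -
    have "((1 + fls_X)\<^sup>2 * inverse fls_X ^ 4 * ((1 + fls_X) * inverse fls_X) ^ k :: real fls) =
      inverse fls_X ^ (k + 4) * fls_X ^ 0 * (1 + fls_X) ^ (k + 2)"
      by (simp add: power_add power_mult_distrib power2_eq_square mult_ac)
    then show ?thesis
      by (simp only: laurent_constant_term) (simp add: int_binomial_def)
  qed
  then show ?thesis by (simp add: label_poly_def sum_distrib_left fls_nth_sum)
qed

lemma nth_X_plus_const_power:
  fixes c :: "'a::comm_ring_1"
  shows "(fps_X + fps_const c) ^ n $ i = (if i \<le> n then of_nat (n choose i) * c ^ (n - i) else 0)"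
proof -
  have "(fps_X + fps_const c) ^ n $ i = (\<Sum>k\<le>n. (of_nat (n choose k) * (fps_X ^ k * fps_const (c ^ (n - k)))) $ i)"
    by (simp add: binomial_ring fps_sum_nth mult.assoc)
  also have "\<dots> = (\<Sum>k\<le>n. if k = i then of_nat (n choose k) * c ^ (n - k) else 0)"
    by (rule sum.cong[OF refl]) (simp only: fps_mult_of_nat_nth fps_X_power_mult_nth, simp)
  finally show ?thesis by simp
qed

text \<open>
The three factors are the binomial coefficients from expanding \<open>(u + 1 + a)\<^sup>t\<close>, \<open>(u + a)\<^sup>s\<close> and the
remaining power of \<open>1 + a\<close>. The index \<open>n - d - j\<close> runs through the powers of \<open>u\<close> taken from the first
factor. The reversal and the shift \<open>d\<close> serve to bring several such sums to a common shape.
\<close>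

definition extraction_term :: "nat \<Rightarrow> nat \<Rightarrow> nat \<Rightarrow> nat \<Rightarrow> nat \<Rightarrow> nat \<Rightarrow> nat \<Rightarrow> nat \<Rightarrow> real" where
  "extraction_term n d r q p s t j =
     int_binomial (int t) (int n - int d - int j) * int_binomial (int s) (int j + int d - int r) *
     int_binomial (int p + int t - int n + int d + int j) (int q - int s - int r + int d + int j)"

text \<open>
The assumption \<open>d < r\<close> guarantees that \<open>j\<close> ranging over \<open>1, \<dots>, n\<close> covers all nonzero terms.
\<close>

lemma constant_term_extraction:
  assumes "d < r"
  shows "((fps_X ^ r * fps_const (inverse fls_X ^ q * (1 + fls_X) ^ p) *
       (fps_X + fps_const fls_X) ^ s * (fps_X + fps_const (1 + fls_X :: real fls)) ^ t) $ n) $$ 0 =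
    (\<Sum>j=1..n. extraction_term n d r q p s t j)"
proof -
  define g where "g k = int_binomial (int t) k * int_binomial (int s) (int n - int r - k) *
       int_binomial (int p + int t - k) (int q - int s + int n - int r - k)" for k :: int
  let ?j = "\<lambda>j. int n - int d - int j"
  have "(\<Sum>j=1..n. extraction_term n d r q p s t j) = (\<Sum>j=1..n. g (?j j))"
    unfolding g_def extraction_term_def
    by (intro sum.cong refl arg_cong2[of _ _ _ _ "(*)"] arg_cong2[of _ _ _ _ int_binomial]) auto
  also have "\<dots> = sum g (?j ` {1..n})"
    by (subst sum.reindex) (auto simp: inj_on_def)
  finally have rhs: "(\<Sum>j=1..n. extraction_term n d r q p s t j) = sum g (?j ` {1..n})" .
  have zero: "g k = 0" if "k < 0 \<or> int n - int r < k" for k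
    using that by (auto simp: g_def int_binomial_def)
  show ?thesis
  proof (cases "n < r")
    case True
    then have "sum g (?j ` {1..n}) = 0" by (intro sum.neutral ballI zero) auto
    then show ?thesis unfolding rhs using True by (simp add: mult.assoc fps_X_power_mult_nth)
  next
    case False
    let ?N = "n - r"
    have "((fps_X ^ r * fps_const (inverse fls_X ^ q * (1 + fls_X) ^ p) *
       (fps_X + fps_const fls_X) ^ s * (fps_X + fps_const (1 + fls_X :: real fls)) ^ t) $ n) $$ 0 =
       (\<Sum>i=0..?N. (inverse fls_X ^ q * (1 + fls_X) ^ p *
         ((fps_X + fps_const (1 + fls_X)) ^ t $ i * (fps_X + fps_const (fls_X :: real fls)) ^ s $ (?N - i))) $$ 0)"
      using False by (simp add: mult.assoc fps_X_power_mult_nth)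
        (simp add: mult.commute[of "(fps_X + fps_const fls_X) ^ s"] fps_mult_nth sum_distrib_left fls_nth_sum mult.assoc)
    also have "\<dots> = (\<Sum>i=0..?N. g (int i))"
    proof (rule sum.cong[OF refl])
      fix i assume i: "i \<in> {0..?N}"
      show "(inverse fls_X ^ q * (1 + fls_X) ^ p *
         ((fps_X + fps_const (1 + fls_X)) ^ t $ i * (fps_X + fps_const (fls_X :: real fls)) ^ s $ (?N - i))) $$ 0 = g (int i)"
      proof (cases "i \<le> t \<and> ?N - i \<le> s")
        case True
        let ?e = "s - (?N - i)"
        have "inverse fls_X ^ q * (1 + fls_X) ^ p *
         ((fps_X + fps_const (1 + fls_X)) ^ t $ i * (fps_X + fps_const (fls_X :: real fls)) ^ s $ (?N - i)) =
          of_nat (t choose i) * (of_nat (s choose (?N - i)) *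
             (inverse fls_X ^ q * fls_X ^ ?e * (1 + fls_X) ^ (p + (t - i))))"
          by (simp only: nth_X_plus_const_power True[THEN conjunct1] True[THEN conjunct2] if_True power_add mult_ac)
        moreover have "int q - int ?e = int q - int s + int n - int r - int i"
          "int (?N - i) = int n - int r - int i" "int (p + (t - i)) = int p + int t - int i"
          using True i False by auto
        ultimately show ?thesis
          unfolding g_def
          by (simp only: fls_mult_of_nat_nth laurent_constant_term int_binomial_of_nat[symmetric])
      next
        case c: False
        then have "g (int i) = 0" using i False by (auto simp: g_def int_binomial_def of_nat_diff)
        then show ?thesis using c by (auto simp: nth_X_plus_const_power)
      qed
    qed
    also have "\<dots> = sum g (int ` {0..?N})" by (subst sum.reindex) auto
    also have "\<dots> = sum g (?j ` {1..n})"
    proof (rule sum.mono_neutral_left)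
      show "int ` {0..?N} \<subseteq> ?j ` {1..n}"
      proof
        fix k assume "k \<in> int ` {0..?N}"
        then obtain i where i: "k = int i" "i \<le> ?N" by auto
        then have "k = ?j (n - d - i)" "n - d - i \<in> {1..n}" using False assms by auto
        then show "k \<in> ?j ` {1..n}" by blast
      qed
      show "\<forall>k\<in>?j ` {1..n} - int ` {0..?N}. g k = 0"
      proof
        fix k assume k: "k \<in> ?j ` {1..n} - int ` {0..?N}"
        show "g k = 0"
        proof (rule zero, rule ccontr)
          assume "\<not> (k < 0 \<or> int n - int r < k)"
          then have "k = int (nat k)" "nat k \<in> {0..?N}" using False by auto
          then show False using k by blast
        qed
      qed
    qed simp
    finally show ?thesis unfolding rhs .
  qed
qed

section \<open>Semi-Baxter numbers as a binomial sum\<close>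

text \<open>
The first factor is the right-hand side of the eliminated kernel relation, the second one is what
remains of the Lagrange factor \<open>\<phi>\<^sup>m\<^sup>+\<^sup>2 (\<phi> - u \<phi>')\<close> for \<open>\<phi> = b \<alpha> \<beta> / a\<close> after \<open>\<alpha> \<beta>\<^sup>2\<close> has been used to
clear denominators. The size is \<open>m + 3\<close> because the exponent of \<open>\<beta>\<close> has to stay nonnegative.
\<close>

lemma monomial_expansion:
  fixes a a' b b' u \<alpha> \<beta> :: "'a::idom"
  assumes inv: "a * a' = 1" "b * b' = 1"
  shows "(u * \<alpha> * \<beta>\<^sup>2 - u\<^sup>2 * a' * b' * \<alpha> * \<beta>\<^sup>2 + u ^ 3 * a' ^ 3 * b' * \<alpha> * \<beta>
      - u ^ 3 * a' ^ 4 * \<alpha> + u\<^sup>2 * a' ^ 4 * b) *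
      ((b * a') ^ (m + 3) * \<alpha> ^ (m + 1) * \<beta> ^ m * (a * b - u\<^sup>2)) =
    u ^ 1 * (a' ^ (m + 2) * b ^ (m + 4)) * \<alpha> ^ (m + 2) * \<beta> ^ (m + 2)
    - u ^ 3 * (a' ^ (m + 3) * b ^ (m + 3)) * \<alpha> ^ (m + 2) * \<beta> ^ (m + 2)
    - u ^ 2 * (a' ^ (m + 3) * b ^ (m + 3)) * \<alpha> ^ (m + 2) * \<beta> ^ (m + 2)
    + u ^ 4 * (a' ^ (m + 4) * b ^ (m + 2)) * \<alpha> ^ (m + 2) * \<beta> ^ (m + 2)
    + u ^ 3 * (a' ^ (m + 5) * b ^ (m + 3)) * \<alpha> ^ (m + 2) * \<beta> ^ (m + 1)
    - u ^ 5 * (a' ^ (m + 6) * b ^ (m + 2)) * \<alpha> ^ (m + 2) * \<beta> ^ (m + 1)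
    - u ^ 3 * (a' ^ (m + 6) * b ^ (m + 4)) * \<alpha> ^ (m + 2) * \<beta> ^ m
    + u ^ 5 * (a' ^ (m + 7) * b ^ (m + 3)) * \<alpha> ^ (m + 2) * \<beta> ^ m
    + u ^ 2 * (a' ^ (m + 6) * b ^ (m + 5)) * \<alpha> ^ (m + 1) * \<beta> ^ m
    - u ^ 4 * (a' ^ (m + 7) * b ^ (m + 4)) * \<alpha> ^ (m + 1) * \<beta> ^ m"
proof -
  define K where "K = (b * a') ^ (m + 3) * \<alpha> ^ (m + 1) * \<beta> ^ m"
  have e0: "u * \<alpha> * \<beta>\<^sup>2 * (K * (a * b)) = u ^ 1 * (a' ^ (m + 2) * b ^ (m + 4)) * \<alpha> ^ (m + 2) * \<beta> ^ (m + 2)"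
  proof -
    have "u * \<alpha> * \<beta>\<^sup>2 * (K * (a * b)) = (a * a') * (u ^ 1 * (a' ^ (m + 2) * b ^ (m + 4)) * \<alpha> ^ (m + 2) * \<beta> ^ (m + 2))"
      unfolding K_def by (simp add: power_mult_distrib power_add eval_nat_numeral mult_ac)
    then show ?thesis unfolding inv by simp
  qed
  have e1: "u * \<alpha> * \<beta>\<^sup>2 * (K * u\<^sup>2) = u ^ 3 * (a' ^ (m + 3) * b ^ (m + 3)) * \<alpha> ^ (m + 2) * \<beta> ^ (m + 2)"
    unfolding K_def by (simp add: power_mult_distrib power_add eval_nat_numeral mult_ac)
  have e2: "u\<^sup>2 * a' * b' * \<alpha> * \<beta>\<^sup>2 * (K * (a * b)) = u ^ 2 * (a' ^ (m + 3) * b ^ (m + 3)) * \<alpha> ^ (m + 2) * \<beta> ^ (m + 2)"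
  proof -
    have "u\<^sup>2 * a' * b' * \<alpha> * \<beta>\<^sup>2 * (K * (a * b)) = (a * a') * (b * b') * (u ^ 2 * (a' ^ (m + 3) * b ^ (m + 3)) * \<alpha> ^ (m + 2) * \<beta> ^ (m + 2))"
      unfolding K_def by (simp add: power_mult_distrib power_add eval_nat_numeral mult_ac)
    then show ?thesis unfolding inv by simp
  qed
  have e3: "u\<^sup>2 * a' * b' * \<alpha> * \<beta>\<^sup>2 * (K * u\<^sup>2) = u ^ 4 * (a' ^ (m + 4) * b ^ (m + 2)) * \<alpha> ^ (m + 2) * \<beta> ^ (m + 2)"
  proof -
    have "u\<^sup>2 * a' * b' * \<alpha> * \<beta>\<^sup>2 * (K * u\<^sup>2) = (b * b') * (u ^ 4 * (a' ^ (m + 4) * b ^ (m + 2)) * \<alpha> ^ (m + 2) * \<beta> ^ (m + 2))"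
      unfolding K_def by (simp add: power_mult_distrib power_add eval_nat_numeral mult_ac)
    then show ?thesis unfolding inv by simp
  qed
  have e4: "u ^ 3 * a' ^ 3 * b' * \<alpha> * \<beta> * (K * (a * b)) = u ^ 3 * (a' ^ (m + 5) * b ^ (m + 3)) * \<alpha> ^ (m + 2) * \<beta> ^ (m + 1)"
  proof -
    have "u ^ 3 * a' ^ 3 * b' * \<alpha> * \<beta> * (K * (a * b)) = (a * a') * (b * b') * (u ^ 3 * (a' ^ (m + 5) * b ^ (m + 3)) * \<alpha> ^ (m + 2) * \<beta> ^ (m + 1))"
      unfolding K_def by (simp add: power_mult_distrib power_add eval_nat_numeral mult_ac)
    then show ?thesis unfolding inv by simp
  qed
  have e5: "u ^ 3 * a' ^ 3 * b' * \<alpha> * \<beta> * (K * u\<^sup>2) = u ^ 5 * (a' ^ (m + 6) * b ^ (m + 2)) * \<alpha> ^ (m + 2) * \<beta> ^ (m + 1)"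
  proof -
    have "u ^ 3 * a' ^ 3 * b' * \<alpha> * \<beta> * (K * u\<^sup>2) = (b * b') * (u ^ 5 * (a' ^ (m + 6) * b ^ (m + 2)) * \<alpha> ^ (m + 2) * \<beta> ^ (m + 1))"
      unfolding K_def by (simp add: power_mult_distrib power_add eval_nat_numeral mult_ac)
    then show ?thesis unfolding inv by simp
  qed
  have e6: "u ^ 3 * a' ^ 4 * \<alpha> * (K * (a * b)) = u ^ 3 * (a' ^ (m + 6) * b ^ (m + 4)) * \<alpha> ^ (m + 2) * \<beta> ^ m"
  proof -
    have "u ^ 3 * a' ^ 4 * \<alpha> * (K * (a * b)) = (a * a') * (u ^ 3 * (a' ^ (m + 6) * b ^ (m + 4)) * \<alpha> ^ (m + 2) * \<beta> ^ m)"
      unfolding K_def by (simp add: power_mult_distrib power_add eval_nat_numeral mult_ac)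
    then show ?thesis unfolding inv by simp
  qed
  have e7: "u ^ 3 * a' ^ 4 * \<alpha> * (K * u\<^sup>2) = u ^ 5 * (a' ^ (m + 7) * b ^ (m + 3)) * \<alpha> ^ (m + 2) * \<beta> ^ m"
    unfolding K_def by (simp add: power_mult_distrib power_add eval_nat_numeral mult_ac)
  have e8: "u\<^sup>2 * a' ^ 4 * b * (K * (a * b)) = u ^ 2 * (a' ^ (m + 6) * b ^ (m + 5)) * \<alpha> ^ (m + 1) * \<beta> ^ m"
  proof -
    have "u\<^sup>2 * a' ^ 4 * b * (K * (a * b)) = (a * a') * (u ^ 2 * (a' ^ (m + 6) * b ^ (m + 5)) * \<alpha> ^ (m + 1) * \<beta> ^ m)"
      unfolding K_def by (simp add: power_mult_distrib power_add eval_nat_numeral mult_ac)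
    then show ?thesis unfolding inv by simp
  qed
  have e9: "u\<^sup>2 * a' ^ 4 * b * (K * u\<^sup>2) = u ^ 4 * (a' ^ (m + 7) * b ^ (m + 4)) * \<alpha> ^ (m + 1) * \<beta> ^ m"
    unfolding K_def by (simp add: power_mult_distrib power_add eval_nat_numeral mult_ac)
  show ?thesis
    unfolding K_def[symmetric] right_diff_distrib distrib_right left_diff_distrib
    by (simp only: e0 e1 e2 e3 e4 e5 e6 e7 e8 e9) (simp add: algebra_simps)
qed

text \<open>
Apply Lagrange inversion to the left-hand side of the eliminated kernel relation and take the
constant term in \<open>a\<close>. The shifts \<open>0, 0, 0, 1, 1, 2, 1, 2, 0, 1\<close> are chosen so that all ten summands
become polynomial multiples of one hypergeometric term of small degree.
\<close>

lemma SB_eq_extraction_sum: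
  "real (SB (m + 3)) = (\<Sum>j=1..m + 3.
     extraction_term (m + 3) 0 1 (m + 2) (m + 4) (m + 2) (m + 2) j
     - extraction_term (m + 3) 0 3 (m + 3) (m + 3) (m + 2) (m + 2) j
     - extraction_term (m + 3) 0 2 (m + 3) (m + 3) (m + 2) (m + 2) j
     + extraction_term (m + 3) 1 4 (m + 4) (m + 2) (m + 2) (m + 2) j
     + extraction_term (m + 3) 1 3 (m + 5) (m + 3) (m + 2) (m + 1) j
     - extraction_term (m + 3) 2 5 (m + 6) (m + 2) (m + 2) (m + 1) j
     - extraction_term (m + 3) 1 3 (m + 6) (m + 4) (m + 2) m j
     + extraction_term (m + 3) 2 5 (m + 7) (m + 3) (m + 2) m j
     + extraction_term (m + 3) 0 2 (m + 6) (m + 5) (m + 1) m j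
     - extraction_term (m + 3) 1 4 (m + 7) (m + 4) (m + 1) m j)"
proof -
  define a a' b b' where "a = fps_const (fls_X :: real fls)" and "a' = fps_const (inverse fls_X :: real fls)"
    and "b = fps_const (1 + fls_X :: real fls)" and "b' = fps_const (inverse (1 + fls_X) :: real fls)"
  have inv: "a * a' = 1" "b * b' = 1"
    unfolding a_def a'_def b_def b'_def using one_plus_fls_X_nonzero by simp_all
  \<comment> \<open>\<open>x\<close> is the solution of the kernel equation at \<open>(b, u + b)\<close>\<close>
  define \<phi> where "\<phi> = b * a' * ((fps_X + a) * (fps_X + b))"
  define x where "x = fps_X * inverse \<phi>"
  have "\<phi> $ 0 \<noteq> 0" using one_plus_fls_X_nonzero
    by (simp add: \<phi>_def a_def a'_def b_def)
  then have x\<phi>: "x * \<phi> = fps_X" by (simp add: x_def mult.assoc inverse_mult_eq_1)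
  have x0: "x $ 0 = 0" by (simp add: x_def)
  have x: "x * b * (fps_X + b) * (fps_X + a) = a * fps_X"
  proof -
    have "a * (x * \<phi>) = (a * a') * (x * b * (fps_X + b) * (fps_X + a))"
      unfolding \<phi>_def by (simp only: mult_ac)
    then show ?thesis unfolding inv x\<phi> by simp
  qed
  define U where "U = x * series_at x (\<lambda>n. label_poly (Suc n) b b)"
  define V where "V = x * series_at x (\<lambda>n. label_poly (Suc n) 1 (b * a'))"
  define c :: "real fls" where "c = (1 + fls_X)\<^sup>2 * inverse fls_X ^ 4"
  \<comment> \<open>\<open>s k\<close> collects the coefficients of \<open>x\<^sup>k\<close>; the reflected part is delayed by one step because of its factor \<open>x\<close>\<close>
  define refl where "refl k = (case k of 0 \<Rightarrow> 0 | Suc l \<Rightarrow>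
     c * label_poly (Suc l) 1 ((1 + fls_X) * inverse fls_X))" for k
  define s where "s k = (case k of 0 \<Rightarrow> 0 | Suc l \<Rightarrow>
     label_poly (Suc l) (1 + fls_X) (1 + fls_X) + refl l)" for k
  have c: "fps_const c = b\<^sup>2 * a' ^ 4" by (simp add: c_def a'_def b_def)
  have ba': "b * a' = fps_const ((1 + fls_X) * inverse fls_X)" by (simp add: a'_def b_def)
  have const_c: "fps_const (c * l) = fps_const c * fps_const l" for l by simp
  have "series_at x (\<lambda>k. fps_const (refl k)) = fps_const c * V"
    unfolding V_def ba'
    by (subst series_at_Suc[OF x0])
      (simp add: refl_def label_poly_const_1 series_at_mult[OF x0] const_c del: fps_const_mult)
  moreover have diag: "label_poly n b b = fps_const (label_poly n (1 + fls_X) (1 + fls_X))" for n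
    unfolding b_def by (rule label_poly_const)
  moreover have const_add: "fps_const (l + l') = fps_const l + fps_const l'" for l l' :: "real fls"
    by simp
  ultimately have series: "series_at x (\<lambda>k. fps_const (s k)) = U + x * b\<^sup>2 * a' ^ 4 * V"
    unfolding U_def diag mult.assoc[of x] c[symmetric]
    by (subst series_at_Suc[OF x0])
      (simp add: s_def const_add series_at_add distrib_left mult_ac del: fps_const_add)
  have constant_term: "s (m + 3) $$ 0 = real (SB (m + 3))"
  proof -
    have "s (Suc (m + 2)) = label_poly (Suc (m + 2)) (1 + fls_X) (1 + fls_X) + refl (Suc (m + 1))"
      by (simp add: s_def)
    then have "s (m + 3) = label_poly (m + 3) (1 + fls_X) (1 + fls_X) +
        (1 + fls_X)\<^sup>2 * inverse fls_X ^ 4 * label_poly (Suc (m + 1)) 1 ((1 + fls_X) * inverse fls_X)"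
      by (simp add: refl_def c_def numeral_3_eq_3)
    then show ?thesis
      using label_poly_diagonal_constant_term[of "m + 3"] label_poly_reflected_constant_term[of "Suc (m + 1)"] by simp
  qed
  have D: "\<phi> - fps_X * fps_deriv \<phi> = b * a' * (a * b - fps_X\<^sup>2)"
  proof -
    have deriv: "fps_deriv a = 0" "fps_deriv a' = 0" "fps_deriv b = 0"
      unfolding a_def a'_def b_def by (simp_all only: fps_deriv_const)
    have deriv_\<phi>: "fps_deriv \<phi> = b * a' * (2 * fps_X + a + b)"
      unfolding \<phi>_def fps_deriv_mult fps_deriv_add fps_deriv_fps_X deriv by (simp add: algebra_simps)
    show ?thesis unfolding deriv_\<phi> unfolding \<phi>_def by (simp add: power2_eq_square algebra_simps)
  qed
  have "series_at x (\<lambda>k. fps_const (s k)) * (\<phi> ^ (m + 2) * (\<phi> - fps_X * fps_deriv \<phi>)) =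
      (fps_X + a) * (fps_X + b)\<^sup>2 * (U + x * b\<^sup>2 * a' ^ 4 * V) *
      ((b * a') ^ (m + 3) * (fps_X + a) ^ (m + 1) * (fps_X + b) ^ m * (a * b - fps_X\<^sup>2))"
    unfolding series D
    unfolding \<phi>_def by (simp add: power_mult_distrib power_add eval_nat_numeral mult_ac)
  also have "(fps_X + a) * (fps_X + b)\<^sup>2 * (U + x * b\<^sup>2 * a' ^ 4 * V) =
    fps_X * (fps_X + a) * (fps_X + b)\<^sup>2 - fps_X\<^sup>2 * a' * b' * (fps_X + a) * (fps_X + b)\<^sup>2
    + fps_X ^ 3 * a' ^ 3 * b' * (fps_X + a) * (fps_X + b)
    - fps_X ^ 3 * a' ^ 4 * (fps_X + a) + fps_X\<^sup>2 * a' ^ 4 * b"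
    unfolding U_def V_def a_def a'_def b_def b'_def
    by (rule orbit_relations[OF x0 x[unfolded a_def b_def]])
  also note monomial_expansion[OF inv]
  finally have expansion: "series_at x (\<lambda>k. fps_const (s k)) * (\<phi> ^ (m + 2) * (\<phi> - fps_X * fps_deriv \<phi>)) =
    fps_X ^ 1 * (a' ^ (m + 2) * b ^ (m + 4)) * (fps_X + a) ^ (m + 2) * (fps_X + b) ^ (m + 2)
    - fps_X ^ 3 * (a' ^ (m + 3) * b ^ (m + 3)) * (fps_X + a) ^ (m + 2) * (fps_X + b) ^ (m + 2)
    - fps_X ^ 2 * (a' ^ (m + 3) * b ^ (m + 3)) * (fps_X + a) ^ (m + 2) * (fps_X + b) ^ (m + 2)
    + fps_X ^ 4 * (a' ^ (m + 4) * b ^ (m + 2)) * (fps_X + a) ^ (m + 2) * (fps_X + b) ^ (m + 2)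
    + fps_X ^ 3 * (a' ^ (m + 5) * b ^ (m + 3)) * (fps_X + a) ^ (m + 2) * (fps_X + b) ^ (m + 1)
    - fps_X ^ 5 * (a' ^ (m + 6) * b ^ (m + 2)) * (fps_X + a) ^ (m + 2) * (fps_X + b) ^ (m + 1)
    - fps_X ^ 3 * (a' ^ (m + 6) * b ^ (m + 4)) * (fps_X + a) ^ (m + 2) * (fps_X + b) ^ m
    + fps_X ^ 5 * (a' ^ (m + 7) * b ^ (m + 3)) * (fps_X + a) ^ (m + 2) * (fps_X + b) ^ m
    + fps_X ^ 2 * (a' ^ (m + 6) * b ^ (m + 5)) * (fps_X + a) ^ (m + 1) * (fps_X + b) ^ m
    - fps_X ^ 4 * (a' ^ (m + 7) * b ^ (m + 4)) * (fps_X + a) ^ (m + 1) * (fps_X + b) ^ m" .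
  have monomial: "(fps_X ^ r * (a' ^ q * b ^ p) * (fps_X + a) ^ s * (fps_X + b) ^ t) $ n $$ 0 =
      (\<Sum>j=1..n. extraction_term n d r q p s t j)" if "d < r" for r q p s t n d
    using constant_term_extraction[OF that, of q p s t n]
    unfolding a_def a'_def b_def by simp
  have "real (SB (m + 3)) = s (Suc (m + 2)) $$ 0" using constant_term by (simp add: numeral_3_eq_3)
  also have "s (Suc (m + 2)) =
      (series_at x (\<lambda>k. fps_const (s k)) * (\<phi> ^ (m + 2) * (\<phi> - fps_X * fps_deriv \<phi>))) $ (m + 3)"
    using lagrange_inversion[OF x0 x\<phi>, of s "m + 2"] by (simp add: numeral_3_eq_3)
  also have "\<dots> $$ 0 = (\<Sum>j=1..m + 3.
     extraction_term (m + 3) 0 1 (m + 2) (m + 4) (m + 2) (m + 2) j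
     - extraction_term (m + 3) 0 3 (m + 3) (m + 3) (m + 2) (m + 2) j
     - extraction_term (m + 3) 0 2 (m + 3) (m + 3) (m + 2) (m + 2) j
     + extraction_term (m + 3) 1 4 (m + 4) (m + 2) (m + 2) (m + 2) j
     + extraction_term (m + 3) 1 3 (m + 5) (m + 3) (m + 2) (m + 1) j
     - extraction_term (m + 3) 2 5 (m + 6) (m + 2) (m + 2) (m + 1) j
     - extraction_term (m + 3) 1 3 (m + 6) (m + 4) (m + 2) m j
     + extraction_term (m + 3) 2 5 (m + 7) (m + 3) (m + 2) m j
     + extraction_term (m + 3) 0 2 (m + 6) (m + 5) (m + 1) m j
     - extraction_term (m + 3) 1 4 (m + 7) (m + 4) (m + 1) m j)"
    unfolding expansion fps_add_nth fps_sub_nth fls_plus_nth fls_minus_nth sum.distrib sum_subtractf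
    by (intro arg_cong2[of _ _ _ _ "(+)"] arg_cong2[of _ _ _ _ "(-)"] monomial) simp_all
  finally show ?thesis .
qed

section \<open>The ten summands over a common hypergeometric term\<close>

text \<open>
These rules express reciprocal factorials through one with the largest argument that occurs, so that
both sides of an identity between hypergeometric terms become products of the same linear factors.
\<close>

lemma inv_fact_int_rules:
  fixes j :: nat
  shows "inv_fact (int j - 3) = (real j - 2) * (real j - 1) * real j * (real j + 1) * (real j + 2) * (real j + 3) * inv_fact (int j + 3)"
    and "inv_fact (int j - 2) = (real j - 1) * real j * (real j + 1) * (real j + 2) * (real j + 3) * inv_fact (int j + 3)"
    and "inv_fact (int j - 1) = real j * (real j + 1) * (real j + 2) * (real j + 3) * inv_fact (int j + 3)"
    and "inv_fact (int j) = (real j + 1) * (real j + 2) * (real j + 3) * inv_fact (int j + 3)"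
    and "inv_fact (int j + 1) = (real j + 2) * (real j + 3) * inv_fact (int j + 3)"
    and "inv_fact (int j + 2) = (real j + 3) * inv_fact (int j + 3)"
  using inv_fact_pred[of "int j + 3"] inv_fact_pred[of "int j + 2"] inv_fact_pred[of "int j + 1"]
    inv_fact_pred[of "int j"] inv_fact_pred[of "int j - 1"] inv_fact_pred[of "int j - 2"]
  by (simp_all add: add_ac)

lemma inv_fact_diff_rules:
  fixes m j :: nat
  shows "inv_fact (int m - int j + 1) = ((real m - real j) + 2) * ((real m - real j) + 3) * ((real m - real j) + 4) * ((real m - real j) + 5) * ((real m - real j) + 6) * inv_fact (int m - int j + 6)"
    and "inv_fact (int m - int j + 2) = ((real m - real j) + 3) * ((real m - real j) + 4) * ((real m - real j) + 5) * ((real m - real j) + 6) * inv_fact (int m - int j + 6)"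
    and "inv_fact (int m - int j + 3) = ((real m - real j) + 4) * ((real m - real j) + 5) * ((real m - real j) + 6) * inv_fact (int m - int j + 6)"
    and "inv_fact (int m - int j + 4) = ((real m - real j) + 5) * ((real m - real j) + 6) * inv_fact (int m - int j + 6)"
    and "inv_fact (int m - int j + 5) = ((real m - real j) + 6) * inv_fact (int m - int j + 6)"
  using inv_fact_pred[of "int m - int j + 6"] inv_fact_pred[of "int m - int j + 5"] inv_fact_pred[of "int m - int j + 4"]
    inv_fact_pred[of "int m - int j + 3"] inv_fact_pred[of "int m - int j + 2"]
  by (simp_all add: add_ac)

lemma inv_fact_size_rules:
  fixes m :: nat
  shows "inv_fact (int m - 1) = real m * (real m + 1) * (real m + 2) * (real m + 3) * (real m + 4) * inv_fact (int m + 4)"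
    and "inv_fact (int m) = (real m + 1) * (real m + 2) * (real m + 3) * (real m + 4) * inv_fact (int m + 4)"
    and "inv_fact (int m + 1) = (real m + 2) * (real m + 3) * (real m + 4) * inv_fact (int m + 4)"
    and "inv_fact (int m + 2) = (real m + 3) * (real m + 4) * inv_fact (int m + 4)"
    and "inv_fact (int m + 3) = (real m + 4) * inv_fact (int m + 4)"
  using inv_fact_pred[of "int m + 4"] inv_fact_pred[of "int m + 3"] inv_fact_pred[of "int m + 2"]
    inv_fact_pred[of "int m + 1"] inv_fact_pred[of "int m"]
  by (simp_all add: add_ac)

lemma fact_size_rules:
  fixes m :: nat
  shows "fact (m + 1) = (real m + 1) * fact m"
    and "fact (m + 2) = (real m + 1) * (real m + 2) * fact m"
  by (simp_all add: eval_nat_numeral algebra_simps)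

lemma fact_sum_rule: "fact (m + 2 + j + 1) = (real m + real j + 3) * fact (m + 2 + j)"
  by (simp add: eval_nat_numeral algebra_simps)

text \<open>
A hypergeometric term of which all ten summands are polynomial multiples: the factorial of an
argument increasing in \<open>j\<close> occurs with the smallest, and each reciprocal factorial with the largest
argument that is needed.
\<close>

definition base_term :: "nat \<Rightarrow> nat \<Rightarrow> real" where
  "base_term m j = fact (m + 1) * fact (m + 2) * inv_fact (int m + 4) *
     (fact (m + 2 + j) * inv_fact (int j + 3) * inv_fact (int j) * inv_fact (int j - 1) *
      inv_fact (int m - int j + 6) * inv_fact (int m - int j + 3))"

lemma extraction_term_1:
  "extraction_term (m + 3) 0 1 (m + 2) (m + 4) (m + 2) (m + 2) j =
   (real m + 2) * (real m + real j + 3) * real j * (real j + 1) * (real j + 2) * (real j + 3) * real j * ((real m - real j) + 4) * ((real m - real j) + 5) * ((real m - real j) + 6) * base_term m j"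
proof -
  have "extraction_term (m + 3) 0 1 (m + 2) (m + 4) (m + 2) (m + 2) j =
      fact (m + 2) * inv_fact (int m - int j + 3) * inv_fact (int j - 1) *
      (fact (m + 2) * inv_fact (int j - 1) * inv_fact (int m - int j + 3)) *
      (fact (m + 2 + j + 1) * inv_fact (int j - 1) * inv_fact (int m + 4))"
    unfolding extraction_term_def int_binomial_def
    by (intro arg_cong2[of _ _ _ _ "(*)"] arg_cong[of _ _ inv_fact] arg_cong[of _ _ fact]) auto
  then show ?thesis
    unfolding base_term_def
    by (simp only: inv_fact_int_rules[of j] inv_fact_diff_rules[of m j] inv_fact_size_rules[of m]
        fact_size_rules[of m] fact_sum_rule[of m j] mult_ac mult_1_left)
qed

lemma extraction_term_2:
  "extraction_term (m + 3) 0 3 (m + 3) (m + 3) (m + 2) (m + 2) j =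
   (real m + 2) * real j * (real j + 1) * (real j + 2) * (real j + 3) * (real j - 1) * real j * (real j - 2) * (real j - 1) * ((real m - real j) + 6) * base_term m j"
proof -
  have "extraction_term (m + 3) 0 3 (m + 3) (m + 3) (m + 2) (m + 2) j =
      fact (m + 2) * inv_fact (int m - int j + 3) * inv_fact (int j - 1) *
      (fact (m + 2) * inv_fact (int j - 3) * inv_fact (int m - int j + 5)) *
      (fact (m + 2 + j) * inv_fact (int j - 2) * inv_fact (int m + 4))"
    unfolding extraction_term_def int_binomial_def
    by (intro arg_cong2[of _ _ _ _ "(*)"] arg_cong[of _ _ inv_fact] arg_cong[of _ _ fact]) auto
  then show ?thesis
    unfolding base_term_def
    by (simp only: inv_fact_int_rules[of j] inv_fact_diff_rules[of m j] inv_fact_size_rules[of m]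
        fact_size_rules[of m] fact_sum_rule[of m j] mult_ac mult_1_left)
qed

lemma extraction_term_3:
  "extraction_term (m + 3) 0 2 (m + 3) (m + 3) (m + 2) (m + 2) j =
   (real m + 2) * (real m + 4) * real j * (real j + 1) * (real j + 2) * (real j + 3) * real j * (real j - 1) * ((real m - real j) + 5) * ((real m - real j) + 6) * base_term m j"
proof -
  have "extraction_term (m + 3) 0 2 (m + 3) (m + 3) (m + 2) (m + 2) j =
      fact (m + 2) * inv_fact (int m - int j + 3) * inv_fact (int j - 1) *
      (fact (m + 2) * inv_fact (int j - 2) * inv_fact (int m - int j + 4)) *
      (fact (m + 2 + j) * inv_fact (int j - 1) * inv_fact (int m + 3))"
    unfolding extraction_term_def int_binomial_def
    by (intro arg_cong2[of _ _ _ _ "(*)"] arg_cong[of _ _ inv_fact] arg_cong[of _ _ fact]) auto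
  then show ?thesis
    unfolding base_term_def
    by (simp only: inv_fact_int_rules[of j] inv_fact_diff_rules[of m j] inv_fact_size_rules[of m]
        fact_size_rules[of m] fact_sum_rule[of m j] mult_ac mult_1_left)
qed

lemma extraction_term_4:
  "extraction_term (m + 3) 1 4 (m + 4) (m + 2) (m + 2) (m + 2) j =
   (real m + 2) * (real m + 4) * (real j + 1) * (real j + 2) * (real j + 3) * real j * (real j - 2) * (real j - 1) * ((real m - real j) + 6) * ((real m - real j) + 3) * base_term m j"
proof -
  have "extraction_term (m + 3) 1 4 (m + 4) (m + 2) (m + 2) (m + 2) j =
      fact (m + 2) * inv_fact (int m - int j + 2) * inv_fact (int j) *
      (fact (m + 2) * inv_fact (int j - 3) * inv_fact (int m - int j + 5)) *
      (fact (m + 2 + j) * inv_fact (int j - 1) * inv_fact (int m + 3))"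
    unfolding extraction_term_def int_binomial_def
    by (intro arg_cong2[of _ _ _ _ "(*)"] arg_cong[of _ _ inv_fact] arg_cong[of _ _ fact]) auto
  then show ?thesis
    unfolding base_term_def
    by (simp only: inv_fact_int_rules[of j] inv_fact_diff_rules[of m j] inv_fact_size_rules[of m]
        fact_size_rules[of m] fact_sum_rule[of m j] mult_ac mult_1_left)
qed

lemma extraction_term_5:
  "extraction_term (m + 3) 1 3 (m + 5) (m + 3) (m + 2) (m + 1) j =
   (real m + 2) * (real m + 3) * (real m + 4) * (real j + 2) * (real j + 3) * real j * (real j - 1) * ((real m - real j) + 5) * ((real m - real j) + 6) * ((real m - real j) + 3) * base_term m j"
proof -
  have "extraction_term (m + 3) 1 3 (m + 5) (m + 3) (m + 2) (m + 1) j =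
      fact (m + 1) * inv_fact (int m - int j + 2) * inv_fact (int j - 1) *
      (fact (m + 2) * inv_fact (int j - 2) * inv_fact (int m - int j + 4)) *
      (fact (m + 2 + j) * inv_fact (int j + 1) * inv_fact (int m + 1))"
    unfolding extraction_term_def int_binomial_def
    by (intro arg_cong2[of _ _ _ _ "(*)"] arg_cong[of _ _ inv_fact] arg_cong[of _ _ fact]) auto
  then show ?thesis
    unfolding base_term_def
    by (simp only: inv_fact_int_rules[of j] inv_fact_diff_rules[of m j] inv_fact_size_rules[of m]
        fact_size_rules[of m] fact_sum_rule[of m j] mult_ac mult_1_left)
qed

lemma extraction_term_6:
  "extraction_term (m + 3) 2 5 (m + 6) (m + 2) (m + 2) (m + 1) j =
   (real m + 2) * (real m + 3) * (real m + 4) * (real j + 2) * (real j + 3) * (real j - 2) * (real j - 1) * ((real m - real j) + 6) * ((real m - real j) + 2) * ((real m - real j) + 3) * base_term m j"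
proof -
  have "extraction_term (m + 3) 2 5 (m + 6) (m + 2) (m + 2) (m + 1) j =
      fact (m + 1) * inv_fact (int m - int j + 1) * inv_fact (int j) *
      (fact (m + 2) * inv_fact (int j - 3) * inv_fact (int m - int j + 5)) *
      (fact (m + 2 + j) * inv_fact (int j + 1) * inv_fact (int m + 1))"
    unfolding extraction_term_def int_binomial_def
    by (intro arg_cong2[of _ _ _ _ "(*)"] arg_cong[of _ _ inv_fact] arg_cong[of _ _ fact]) auto
  then show ?thesis
    unfolding base_term_def
    by (simp only: inv_fact_int_rules[of j] inv_fact_diff_rules[of m j] inv_fact_size_rules[of m]
        fact_size_rules[of m] fact_sum_rule[of m j] mult_ac mult_1_left)
qed

lemma extraction_term_7:
  "extraction_term (m + 3) 1 3 (m + 6) (m + 4) (m + 2) m j =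
   (real m + 2) * (real m + 3) * (real m + 4) * (real j + 3) * (real j - 1) * real j * (real j - 1) * ((real m - real j) + 5) * ((real m - real j) + 6) * ((real m - real j) + 3) * base_term m j"
proof -
  have "extraction_term (m + 3) 1 3 (m + 6) (m + 4) (m + 2) m j =
      fact m * inv_fact (int m - int j + 2) * inv_fact (int j - 2) *
      (fact (m + 2) * inv_fact (int j - 2) * inv_fact (int m - int j + 4)) *
      (fact (m + 2 + j) * inv_fact (int j + 2) * inv_fact (int m))"
    unfolding extraction_term_def int_binomial_def
    by (intro arg_cong2[of _ _ _ _ "(*)"] arg_cong[of _ _ inv_fact] arg_cong[of _ _ fact]) auto
  then show ?thesis
    unfolding base_term_def
    by (simp only: inv_fact_int_rules[of j] inv_fact_diff_rules[of m j] inv_fact_size_rules[of m]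
        fact_size_rules[of m] fact_sum_rule[of m j] mult_ac mult_1_left)
qed

lemma extraction_term_8:
  "extraction_term (m + 3) 2 5 (m + 7) (m + 3) (m + 2) m j =
   (real m + 2) * (real m + 3) * (real m + 4) * (real j + 3) * real j * (real j - 2) * (real j - 1) * ((real m - real j) + 6) * ((real m - real j) + 2) * ((real m - real j) + 3) * base_term m j"
proof -
  have "extraction_term (m + 3) 2 5 (m + 7) (m + 3) (m + 2) m j =
      fact m * inv_fact (int m - int j + 1) * inv_fact (int j - 1) *
      (fact (m + 2) * inv_fact (int j - 3) * inv_fact (int m - int j + 5)) *
      (fact (m + 2 + j) * inv_fact (int j + 2) * inv_fact (int m))"
    unfolding extraction_term_def int_binomial_def
    by (intro arg_cong2[of _ _ _ _ "(*)"] arg_cong[of _ _ inv_fact] arg_cong[of _ _ fact]) auto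
  then show ?thesis
    unfolding base_term_def
    by (simp only: inv_fact_int_rules[of j] inv_fact_diff_rules[of m j] inv_fact_size_rules[of m]
        fact_size_rules[of m] fact_sum_rule[of m j] mult_ac mult_1_left)
qed

lemma extraction_term_9:
  "extraction_term (m + 3) 0 2 (m + 6) (m + 5) (m + 1) m j =
   real m * (real m + 3) * (real m + 4) * (real j - 1) * real j * (real j - 2) * (real j - 1) * ((real m - real j) + 4) * ((real m - real j) + 5) * ((real m - real j) + 6) * base_term m j"
proof -
  have "extraction_term (m + 3) 0 2 (m + 6) (m + 5) (m + 1) m j =
      fact m * inv_fact (int m - int j + 3) * inv_fact (int j - 3) *
      (fact (m + 1) * inv_fact (int j - 2) * inv_fact (int m - int j + 3)) *
      (fact (m + 2 + j) * inv_fact (int j + 3) * inv_fact (int m - 1))"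
    unfolding extraction_term_def int_binomial_def
    by (intro arg_cong2[of _ _ _ _ "(*)"] arg_cong[of _ _ inv_fact] arg_cong[of _ _ fact]) auto
  then show ?thesis
    unfolding base_term_def
    by (simp only: inv_fact_int_rules[of j] inv_fact_diff_rules[of m j] inv_fact_size_rules[of m]
        fact_size_rules[of m] fact_sum_rule[of m j] mult_ac mult_1_left)
qed

lemma extraction_term_10:
  "extraction_term (m + 3) 1 4 (m + 7) (m + 4) (m + 1) m j =
   real m * (real m + 3) * (real m + 4) * (real j - 1) * real j * (real j - 2) * (real j - 1) * ((real m - real j) + 5) * ((real m - real j) + 6) * ((real m - real j) + 3) * base_term m j"
proof -
  have "extraction_term (m + 3) 1 4 (m + 7) (m + 4) (m + 1) m j =
      fact m * inv_fact (int m - int j + 2) * inv_fact (int j - 2) *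
      (fact (m + 1) * inv_fact (int j - 3) * inv_fact (int m - int j + 4)) *
      (fact (m + 2 + j) * inv_fact (int j + 3) * inv_fact (int m - 1))"
    unfolding extraction_term_def int_binomial_def
    by (intro arg_cong2[of _ _ _ _ "(*)"] arg_cong[of _ _ inv_fact] arg_cong[of _ _ fact]) auto
  then show ?thesis
    unfolding base_term_def
    by (simp only: inv_fact_int_rules[of j] inv_fact_diff_rules[of m j] inv_fact_size_rules[of m]
        fact_size_rules[of m] fact_sum_rule[of m j] mult_ac mult_1_left)
qed

section \<open>Equality of the three sums\<close>

lemma binomial_inv_fact:
  "real (m choose k) = fact m * inv_fact (int k) * inv_fact (int m - int k)"
  using int_binomial_of_nat[of m k] by (simp add: int_binomial_def)

definition first_summand :: "nat \<Rightarrow> nat \<Rightarrow> real" where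
  "first_summand n j = real (n choose (j + 2)) * real ((n + 2) choose j) * real ((n + j + 2) choose (j + 1))"

definition second_summand :: "nat \<Rightarrow> nat \<Rightarrow> real" where
  "second_summand n j = real (n choose (j + 2)) * real ((n + 1) choose j) * real ((n + j + 2) choose (j + 3))"

definition third_summand :: "nat \<Rightarrow> nat \<Rightarrow> real" where
  "third_summand n j = real ((n + 1) choose (j + 3)) * real ((n + 2) choose (j + 1)) * real ((n + j + 3) choose j)"

lemma inv_fact_small_diff_rules:
  fixes n j :: nat
  shows "inv_fact (int n - int j - 3) = (real n - real j - 2) * inv_fact (int n - int j - 2)"
    and "inv_fact (int n - int j + 1) = (real n - real j + 2) * inv_fact (int n - int j + 2)"
  using inv_fact_pred[of "int n - int j - 2"] inv_fact_pred[of "int n - int j + 2"]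
  by (simp_all add: add_ac)

lemma fact_times_inv_fact:
  "fact (n + 2) * inv_fact (int n + 1) = real n + 2"
  "fact (n + 1) * inv_fact (int n - 1) = (real n + 1) * real n"
  "fact (n + 2) * inv_fact (int n + 3) = 1 / (real n + 3)"
proof -
  have "inv_fact (int n + 1) = 1 / fact (n + 1)" by (simp add: inv_fact_def nat_add_distrib)
  moreover have "fact (n + 2) = (real n + 2) * fact (n + 1)" by (simp add: eval_nat_numeral add_ac)
  ultimately show "fact (n + 2) * inv_fact (int n + 1) = real n + 2"
    by (simp del: fact_Suc)
  have "inv_fact (int n) = 1 / fact n" by (simp add: inv_fact_def)
  then show "fact (n + 1) * inv_fact (int n - 1) = (real n + 1) * real n"
    by (simp add: inv_fact_pred add_ac)
  have "inv_fact (int n + 3) = 1 / fact (n + 3)" by (simp add: inv_fact_def nat_add_distrib)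
  moreover have "fact (n + 3) = (real n + 3) * fact (n + 2)" by (simp add: eval_nat_numeral add_ac)
  ultimately show "fact (n + 2) * inv_fact (int n + 3) = 1 / (real n + 3)"
    by (simp del: fact_Suc)
qed

text \<open>
The difference of the summands telescopes, with \<open>G\<close> as certificate; both are polynomial multiples of
\<open>D\<close>. Since \<open>G\<close> contains the reciprocal factorials of \<open>j - 1\<close> and \<open>n - j - 2\<close>, it vanishes at \<open>j = 0\<close>
and at \<open>j = n + 1\<close>.
\<close>

lemma sum_first_eq_sum_second:
  "(\<Sum>j=0..n. first_summand n j) = (\<Sum>j=0..n. second_summand n j)"
proof -
  define D where "D j = fact n * fact (n + j + 2) * inv_fact (int j + 3) * inv_fact (int j + 2) *
    inv_fact (int j) * inv_fact (int n - int j + 2) * inv_fact (int n - int j - 2)" for j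
  define G where "G j = fact n * fact (n + j + 2) * inv_fact (int j + 2) * inv_fact (int j + 1) *
    inv_fact (int j - 1) * inv_fact (int n - int j + 2) * inv_fact (int n - int j - 2)" for j
  have step: "first_summand n j - second_summand n j = - (G (Suc j) - G j)" for j
  proof -
    note rules = inv_fact_int_rules[of j] inv_fact_small_diff_rules[of n j]
    have "first_summand n j = (fact (n + 2) * inv_fact (int n + 1)) * (fact n * fact (n + j + 2) * inv_fact (int j + 2) *
      inv_fact (int j + 1) * inv_fact (int j) * inv_fact (int n - int j + 2) * inv_fact (int n - int j - 2))"
      unfolding first_summand_def binomial_inv_fact by (simp add: algebra_simps)
    then have 1: "first_summand n j = (real n + 2) * (real j + 3) * (real j + 2) * D j"
      unfolding fact_times_inv_fact D_def by (simp only: rules mult_ac)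
    have "second_summand n j = (fact (n + 1) * inv_fact (int n - 1)) * (fact n * fact (n + j + 2) * inv_fact (int j + 3) *
      inv_fact (int j + 2) * inv_fact (int j) * inv_fact (int n - int j + 1) * inv_fact (int n - int j - 2))"
      unfolding second_summand_def binomial_inv_fact by (simp add: algebra_simps)
    then have 2: "second_summand n j = (real n + 1) * real n * (real n - real j + 2) * D j"
      unfolding fact_times_inv_fact D_def by (simp only: rules mult_ac)
    have 3: "G j = (real j + 3) * (real j + 2) * real j * D j"
      unfolding G_def D_def by (simp only: rules mult_ac)
    have "fact (n + j + 3) = (real n + real j + 3) * fact (n + j + 2)"
      by (simp add: eval_nat_numeral add_ac)
    then have "G (Suc j) = fact n * ((real n + real j + 3) * fact (n + j + 2)) * inv_fact (int j + 3) * inv_fact (int j + 2) *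
       inv_fact (int j) * inv_fact (int n - int j + 1) * inv_fact (int n - int j - 3)"
      unfolding G_def by (simp add: algebra_simps)
    then have 4: "G (Suc j) = (real n + real j + 3) * (real n - real j + 2) * (real n - real j - 2) * D j"
      unfolding D_def by (simp only: rules mult_ac)
    show ?thesis unfolding 1 2 3 4 by algebra
  qed
  have "(\<Sum>j=0..n. first_summand n j - second_summand n j) = - (\<Sum>j=0..n. G (Suc j) - G j)"
    unfolding step sum_negf ..
  also have "(\<Sum>j=0..n. G (Suc j) - G j) = G (Suc n) - G 0"
    by (rule sum_Suc_diff) simp
  also have "\<dots> = 0" by (simp add: G_def)
  finally show ?thesis by (simp add: sum_subtractf)
qed

text \<open>
The same method with another certificate; here the factor \<open>n + 3\<close> clears the denominator of the
third summand relative to \<open>D\<close>.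
\<close>

lemma sum_first_eq_sum_third:
  "(\<Sum>j=0..n. first_summand n j) = (\<Sum>j=0..n. third_summand n j)"
proof -
  define D where "D j = fact n * fact (n + j + 2) * inv_fact (int j + 3) * inv_fact (int j + 1) *
    inv_fact (int j) * inv_fact (int n - int j + 2) * inv_fact (int n - int j - 2)" for j
  define G where "G j = fact n * fact (n + j + 2) * inv_fact (int j + 2) * inv_fact (int j) *
    inv_fact (int j - 1) * inv_fact (int n - int j + 2) * inv_fact (int n - int j - 2)" for j
  have step: "(real n + 3) * (first_summand n j - third_summand n j) = - (G (Suc j) - G j)" for j
  proof -
    note rules = inv_fact_int_rules[of j] inv_fact_small_diff_rules[of n j]
    have "first_summand n j = (fact (n + 2) * inv_fact (int n + 1)) * (fact n * fact (n + j + 2) * inv_fact (int j + 2) *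
      inv_fact (int j + 1) * inv_fact (int j) * inv_fact (int n - int j + 2) * inv_fact (int n - int j - 2))"
      unfolding first_summand_def binomial_inv_fact by (simp add: algebra_simps)
    then have 1: "first_summand n j = (real n + 2) * (real j + 3) * D j"
      unfolding fact_times_inv_fact D_def by (simp only: rules mult_ac)
    have fact3: "fact (n + j + 3) = (real n + real j + 3) * fact (n + j + 2)"
      by (simp add: eval_nat_numeral add_ac)
    have fact1: "fact (n + 1) = (real n + 1) * fact n" by simp
    have "third_summand n j = (fact (n + 2) * inv_fact (int n + 3)) * (fact (n + 1) * fact (n + j + 3) * inv_fact (int j + 3) *
      inv_fact (int j + 1) * inv_fact (int j) * inv_fact (int n - int j + 1) * inv_fact (int n - int j - 2))"
      unfolding third_summand_def binomial_inv_fact by (simp add: algebra_simps)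
    then have "third_summand n j = 1 / (real n + 3) * ((real n + 1) * (real n + real j + 3) * (real n - real j + 2) * D j)"
      unfolding fact_times_inv_fact D_def fact1 fact3 by (simp only: rules mult_ac)
    then have 2: "(real n + 3) * third_summand n j = (real n + 1) * (real n + real j + 3) * (real n - real j + 2) * D j"
      by simp
    have 3: "G j = (real j + 3) * (real j + 1) * real j * D j"
      unfolding G_def D_def by (simp only: rules mult_ac)
    have "G (Suc j) = fact n * ((real n + real j + 3) * fact (n + j + 2)) * inv_fact (int j + 3) * inv_fact (int j + 1) *
       inv_fact (int j) * inv_fact (int n - int j + 1) * inv_fact (int n - int j - 3)"
      using fact3 unfolding G_def by (simp add: algebra_simps)
    then have 4: "G (Suc j) = (real n + real j + 3) * (real n - real j + 2) * (real n - real j - 2) * D j"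
      unfolding D_def by (simp only: rules mult_ac)
    show ?thesis unfolding right_diff_distrib 1 2 3 4 by algebra
  qed
  have "(real n + 3) * (\<Sum>j=0..n. first_summand n j - third_summand n j) = - (\<Sum>j=0..n. G (Suc j) - G j)"
    unfolding sum_distrib_left step sum_negf ..
  also have "(\<Sum>j=0..n. G (Suc j) - G j) = G (Suc n) - G 0"
    by (rule sum_Suc_diff) simp
  also have "\<dots> = 0" by (simp add: G_def)
  finally show ?thesis by (simp add: sum_subtractf)
qed

section \<open>Telescoping to the first sum\<close>

text \<open>
The polynomial part of the certificate, computed by Gosper's algorithm: as a polynomial in \<open>J\<close> of
degree \<open>6\<close> it solves a linear system over the rational functions in \<open>N\<close>, and the factor
\<open>(N + 2) (N + 3)\<close> clears the denominators of the solution.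
\<close>

definition gosper_poly :: "real \<Rightarrow> real \<Rightarrow> real" where
  "gosper_poly N J =
    (- 12 * N ^ 5 - 24 * N ^ 4 + 156 * N ^ 3 + 288 * N ^ 2 + 72 * N)
    + (- 4 * N ^ 5 - 62 * N ^ 4 - 312 * N ^ 3 - 546 * N ^ 2 - 468 * N - 144) * J
    + (3 * N ^ 5 + 39 * N ^ 4 + 199 * N ^ 3 + 347 * N ^ 2 + 60 * N - 144) * J ^ 2
    + (N ^ 5 - 2 * N ^ 4 - 57 * N ^ 3 - 156 * N ^ 2 - 98 * N - 24) * J ^ 3
    + (9 * N ^ 3 + 38 * N ^ 2 + 19 * N - 42) * J ^ 4
    + (N ^ 4 + 6 * N ^ 3 + 9 * N ^ 2 - 4 * N - 12) * J ^ 5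
    + (- 1 * N ^ 3 - 4 * N ^ 2 - N + 6) * J ^ 6"

text \<open>
The sum of the ten cofactors of the base term, where \<open>M\<close> is the size minus \<open>3\<close>.
\<close>

definition extraction_poly :: "real \<Rightarrow> real \<Rightarrow> real" where
  "extraction_poly M J =
     (M + 2) * (M + J + 3) * J * (J + 1) * (J + 2) * (J + 3) * J * (M - J + 4) * (M - J + 5) * (M - J + 6)
     - (M + 2) * J * (J + 1) * (J + 2) * (J + 3) * (J - 1) * J * (J - 2) * (J - 1) * (M - J + 6)
     - (M + 2) * (M + 4) * J * (J + 1) * (J + 2) * (J + 3) * J * (J - 1) * (M - J + 5) * (M - J + 6)
     + (M + 2) * (M + 4) * (J + 1) * (J + 2) * (J + 3) * J * (J - 2) * (J - 1) * (M - J + 6) * (M - J + 3)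
     + (M + 2) * (M + 3) * (M + 4) * (J + 2) * (J + 3) * J * (J - 1) * (M - J + 5) * (M - J + 6) * (M - J + 3)
     - (M + 2) * (M + 3) * (M + 4) * (J + 2) * (J + 3) * (J - 2) * (J - 1) * (M - J + 6) * (M - J + 2) * (M - J + 3)
     - (M + 2) * (M + 3) * (M + 4) * (J + 3) * (J - 1) * J * (J - 1) * (M - J + 5) * (M - J + 6) * (M - J + 3)
     + (M + 2) * (M + 3) * (M + 4) * (J + 3) * J * (J - 2) * (J - 1) * (M - J + 6) * (M - J + 2) * (M - J + 3)
     + M * (M + 3) * (M + 4) * (J - 1) * J * (J - 2) * (J - 1) * (M - J + 4) * (M - J + 5) * (M - J + 6)
     - M * (M + 3) * (M + 4) * (J - 1) * J * (J - 2) * (J - 1) * (M - J + 5) * (M - J + 6) * (M - J + 3)"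

lemma gosper_poly_identity:
  fixes M J :: real
  shows "(M + 5) * (M + 6) *
      (extraction_poly M J - 24 * (M + J + 3) * (M + J + 4) * (J + 2) * (J + 3) * (M - J + 3)) =
    (M + J + 3) * (M - J + 6) * (M - J + 3) * gosper_poly (M + 3) (J + 1)
    - (J + 3) * J * (J - 1) * gosper_poly (M + 3) J"
  unfolding gosper_poly_def extraction_poly_def by algebra

lemma first_summand_base_term:
  "24 / ((real m + 2) * (real m + 3)\<^sup>2 * (real m + 4) * (real m + 5)) * first_summand (m + 3) i =
   24 * (real m + real (Suc i) + 3) * (real m + real (Suc i) + 4) * (real (Suc i) + 2) * (real (Suc i) + 3) *
     (real m - real (Suc i) + 3) * base_term m (Suc i)"
proof -
  define j where "j = Suc i"
  define c where "c = (real m + 2) * (real m + 3)\<^sup>2 * (real m + 4) * (real m + 5)"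
  have "c \<noteq> 0" unfolding c_def by (simp add: add_eq_0_iff)
  have f3: "fact (m + 3) = (real m + 2) * (real m + 3) * fact (m + 1)"
    and f5: "fact (m + 5) = (real m + 3) * (real m + 4) * (real m + 5) * fact (m + 2)"
    and f4: "fact (m + j + 4) = (real m + real j + 3) * (real m + real j + 4) * fact (m + 2 + j)"
    by (simp_all add: eval_nat_numeral algebra_simps)
  have "first_summand (m + 3) i =
      (fact (m + 3) * inv_fact (int j + 1) * inv_fact (int m - int j + 2)) *
      (fact (m + 5) * inv_fact (int j - 1) * inv_fact (int m - int j + 6)) *
      (fact (m + j + 4) * inv_fact (int j) * inv_fact (int m + 4))"
    unfolding first_summand_def binomial_inv_fact j_def
    by (intro arg_cong2[of _ _ _ _ "(*)"] arg_cong[of _ _ inv_fact] arg_cong[of _ _ fact]) auto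
  then have "first_summand (m + 3) i =
      c * ((real m + real j + 3) * (real m + real j + 4) * (real j + 2) * (real j + 3) *
        (real m - real j + 3) * base_term m j)"
    unfolding base_term_def c_def f3 f4 f5 power2_eq_square
    by (simp only: inv_fact_int_rules[of j] inv_fact_diff_rules[of m j] mult_ac)
  then show ?thesis using \<open>c \<noteq> 0\<close> unfolding c_def[symmetric] j_def by simp
qed

text \<open>
The difference between the extracted summand and the first summand, shifted by one, is the
difference \<open>G(j + 1) - G(j)\<close> up to a constant. The certificate \<open>G\<close> vanishes at \<open>j = 1\<close> and at
\<open>j = m + 4\<close> because \<open>H\<close> contains the reciprocal factorials of \<open>j - 2\<close> and of \<open>m + 3 - j\<close>.
\<close>

lemma SB_eq_first_sum:
  "real (SB (m + 3)) =
     24 / ((real m + 2) * (real m + 3)\<^sup>2 * (real m + 4) * (real m + 5)) * (\<Sum>j=0..m + 3. first_summand (m + 3) j)"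
proof -
  define target where "target j = 24 * (real m + real j + 3) * (real m + real j + 4) * (real j + 2) * (real j + 3) *
     (real m - real j + 3) * base_term m j" for j
  define terms where "terms j = extraction_term (m + 3) 0 1 (m + 2) (m + 4) (m + 2) (m + 2) j
      - extraction_term (m + 3) 0 3 (m + 3) (m + 3) (m + 2) (m + 2) j
      - extraction_term (m + 3) 0 2 (m + 3) (m + 3) (m + 2) (m + 2) j
      + extraction_term (m + 3) 1 4 (m + 4) (m + 2) (m + 2) (m + 2) j
      + extraction_term (m + 3) 1 3 (m + 5) (m + 3) (m + 2) (m + 1) j
      - extraction_term (m + 3) 2 5 (m + 6) (m + 2) (m + 2) (m + 1) j
      - extraction_term (m + 3) 1 3 (m + 6) (m + 4) (m + 2) m j
      + extraction_term (m + 3) 2 5 (m + 7) (m + 3) (m + 2) m j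
      + extraction_term (m + 3) 0 2 (m + 6) (m + 5) (m + 1) m j
      - extraction_term (m + 3) 1 4 (m + 7) (m + 4) (m + 1) m j" for j
  define H where "H j = fact (m + 1) * fact (m + 2) * inv_fact (int m + 4) *
     (fact (m + 2 + j) * inv_fact (int j + 2) * inv_fact (int j - 1) * inv_fact (int j - 2) *
      inv_fact (int m - int j + 6) * inv_fact (int m - int j + 3))" for j
  define G where "G j = gosper_poly (real m + 3) (real j) * H j" for j
  have step: "(real m + 5) * (real m + 6) * (terms j - target j) = G (Suc j) - G j" for j
  proof -
    have terms: "terms j = extraction_poly (real m) (real j) * base_term m j"
      unfolding terms_def extraction_term_1 extraction_term_2 extraction_term_3 extraction_term_4 extraction_term_5
        extraction_term_6 extraction_term_7 extraction_term_8 extraction_term_9 extraction_term_10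
        extraction_poly_def
      by (simp only: distrib_right left_diff_distrib)
    have H: "H j = (real j + 3) * real j * (real j - 1) * base_term m j"
      unfolding H_def base_term_def
      by (simp only: inv_fact_int_rules[of j] mult_ac)
    have "H (Suc j) = fact (m + 1) * fact (m + 2) * inv_fact (int m + 4) *
     (fact (m + 2 + j + 1) * inv_fact (int j + 3) * inv_fact (int j) * inv_fact (int j - 1) *
      inv_fact (int m - int j + 5) * inv_fact (int m - int j + 2))"
      unfolding H_def
      by (intro arg_cong2[of _ _ _ _ "(*)"] arg_cong[of _ _ inv_fact] arg_cong[of _ _ fact]) auto
    then have H': "H (Suc j) = (real m + real j + 3) * (real m - real j + 6) * (real m - real j + 3) * base_term m j"
      unfolding base_term_def fact_sum_rule
      by (simp only: inv_fact_diff_rules[of m j] mult_ac)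
    have J': "real (Suc j) = real j + 1" by simp
    have "(real m + 5) * (real m + 6) * (terms j - target j) =
      ((real m + 5) * (real m + 6) * (extraction_poly (real m) (real j)
        - 24 * (real m + real j + 3) * (real m + real j + 4) * (real j + 2) * (real j + 3) * (real m - real j + 3))) * base_term m j"
      unfolding terms target_def by (simp only: left_diff_distrib right_diff_distrib mult.assoc)
    also have "\<dots> = G (Suc j) - G j"
      unfolding gosper_poly_identity G_def H H' J' left_diff_distrib by (simp only: mult_ac)
    finally show ?thesis .
  qed
  have "(real m + 5) * (real m + 6) * (\<Sum>j=1..m + 3. terms j - target j) = (\<Sum>j=1..m + 3. G (Suc j) - G j)"
    unfolding sum_distrib_left step ..
  also have "\<dots> = G (Suc (m + 3)) - G 1" by (rule sum_Suc_diff) simp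
  also have "\<dots> = 0" by (simp add: G_def H_def)
  finally have "(\<Sum>j=1..m + 3. terms j - target j) = 0" by (simp add: add_eq_0_iff)
  then have "real (SB (m + 3)) = (\<Sum>j=1..m + 3. target j)"
    unfolding SB_eq_extraction_sum terms_def[symmetric] by (simp add: sum_subtractf)
  also have "\<dots> = (\<Sum>i=0..m + 2. target (Suc i))"
    using sum.shift_bounds_cl_Suc_ivl[of target 0 "m + 2"] by (simp add: eval_nat_numeral)
  also have "\<dots> = 24 / ((real m + 2) * (real m + 3)\<^sup>2 * (real m + 4) * (real m + 5)) * (\<Sum>i=0..m + 2. first_summand (m + 3) i)"
    unfolding target_def first_summand_base_term[symmetric] sum_distrib_left ..
  also have "(\<Sum>i=0..m + 2. first_summand (m + 3) i) = (\<Sum>i=0..m + 3. first_summand (m + 3) i)"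
    by (rule sum.mono_neutral_left) (auto simp: first_summand_def)
  finally show ?thesis .
qed

lemma SB_2: "SB 2 = 2"
proof -
  have "semi_baxter 2 \<pi> \<longleftrightarrow> \<pi> permutes {1..2}" for \<pi>
    unfolding semi_baxter_def by auto
  then show ?thesis by (simp add: SB_def card_permutations[OF refl])
qed

theorem theorem14:
  fixes n :: nat
  assumes "n \<ge> 2"
  shows
    "(real (SB n) =
       24 / ((real n - 1) * (real n)\<^sup>2 * (real n + 1) * (real n + 2)) *
       (\<Sum>j=0..n. real (n choose (j + 2)) * real ((n + 2) choose j) * real ((n + j + 2) choose (j + 1)))) \<and>
     (real (SB n) =
       24 / ((real n - 1) * (real n)\<^sup>2 * (real n + 1) * (real n + 2)) *
       (\<Sum>j=0..n. real (n choose (j + 2)) * real ((n + 1) choose j) * real ((n + j + 2) choose (j + 3)))) \<and>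
     (real (SB n) =
       24 / ((real n - 1) * (real n)\<^sup>2 * (real n + 1) * (real n + 2)) *
       (\<Sum>j=0..n. real ((n + 1) choose (j + 3)) * real ((n + 2) choose (j + 1)) * real ((n + j + 3) choose j)))"
proof -
  define c where "c = 24 / ((real n - 1) * (real n)\<^sup>2 * (real n + 1) * (real n + 2))"
  have "real (SB n) = c * (\<Sum>j=0..n. first_summand n j)"
  \<comment> \<open>the sum obtained from Lagrange inversion requires \<open>n \<ge> 3\<close>\<close>
  proof (cases "n = 2")
    case True
    have "(\<Sum>j=0..2. first_summand 2 j) = 4"
      by (simp add: first_summand_def eval_nat_numeral)
    then show ?thesis unfolding c_def True SB_2 by simp
  next
    case False
    then obtain m where m: "n = m + 3" using assms by (metis add.commute le_Suc_ex le_neq_implies_less Suc_leI eval_nat_numeral(3))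
    then have "c = 24 / ((real m + 2) * (real m + 3)\<^sup>2 * (real m + 4) * (real m + 5))"
      by (simp add: c_def add_ac)
    then show ?thesis using SB_eq_first_sum[of m] unfolding m by simp
  qed
  then show ?thesis
    using sum_first_eq_sum_second[of n] sum_first_eq_sum_third[of n]
    unfolding c_def first_summand_def second_summand_def third_summand_def by simp
qed

end
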